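(* Let $k\in\{1,2,\dots\}\cup\{\infty\}$ and let $(Q_i,\,0\le i\le k)$ be a sequence of transition matrices on $\mathbb{Z}^2$ which are translation invariant and satisfy property (F). Assume that for all $1\le i\le k$, $Q_0$ is successfully coupled with $Q_i$. Assume further that $P_0=\varphi(Q_0)$ is transient. Then for any process $(S_0,(S_n,i(n))_{n\ge1})$ which satisfies (CL) with $P_i=\varphi(Q_i)$, $1\le i\le k$, the process $\{S_n\}_{n\ge0}$ is transient.
   Context: Notation: $\mathbb{N}_k=\{1,\dots,k\}$, and when $k=\infty$ the index $i$ runs over all positive integers. Property (F) and $\varphi$: for a transition matrix $Q$ on $\mathbb{Z}^2$, let $(U,V)$ be a Markov chain with transition matrix $Q$ started at $(0,0)$ and $T=T(Q)=\inf\{n>0: V(n)=0\}$. $Q$ satisfies (F) if $T$ is a.s. finite; then $\varphi(Q)$ denotes the law of $U_T$, a probability law on $\mathbb{Z}$. Translation invariance: $Q[(u,v),(u',v')]=Q[(0,v),(u'-u,v')]$ for all $u,u',v,v'\in\mathbb{Z}$. Successful coupling: for translation invariant transition matrices $Q,Q'$ on $\mathbb{Z}^2$, "$Q$ is successfully coupled with $Q'$" means there is a transition matrix $\widehat Q$ on $\mathbb{Z}^3$ such that (i) $\sum_{w'}\widehat Q((u,v,w),(u',v',w'))=Q'((u,v),(u',v'))$ for all $u,v,w,u',v'$; (ii) $\sum_{v'}\widehat Q((u,v,w),(u',v',w'))=Q((u,w),(u',w'))$ for all $u,v,w,u',w'$; (iii) $\widehat Q((u,v,w),(u',v',w'))=0$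 whenever $|w|\le|v|+1$ and $|w'|>|v'|+1$. The relation is not symmetric; in the claim $Q_0$ plays the role of $Q$ and $Q_i$ the role of $Q'$. Transience: a process on $\mathbb{Z}$ is transient if almost surely it comes back a finite number of times to each site. A law on $\mathbb{Z}$ is transient if the random walk with i.i.d. steps of that law is transient. (CL): given laws $(P_i)_{i\in\mathbb{N}_k}$ on $\mathbb{Z}$, a process $(S_0,(S_n,i(n))_{n\ge1})$ with $S_n\in\mathbb{Z}$ and $i(n)\in\mathbb{N}_k$ satisfies (CL) if for all $n\ge0$ the conditional law of $X_{n+1}=S_{n+1}-S_n$ given $\mathcal{H}_n\vee\sigma(i(n+1))$ is $P_{i(n+1)}$, where $\mathcal{H}_n=\sigma(S_0)\vee\sigma((S_\ell,i(\ell))_{1\le\ell\le n})$. *)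

theory Defs
  imports "HOL-Probability.Probability" "HOL-Library.Extended_Nat"
begin

text \<open>
  A transition matrix on a countable set \<open>'s\<close> is a map \<open>Q :: 's \<Rightarrow> 's pmf\<close>; its entry at
  \<open>(x, y)\<close> is \<open>pmf (Q x) y\<close>.
\<close>

definition markov_chain ::
    "'w measure \<Rightarrow> ('s \<Rightarrow> 's pmf) \<Rightarrow> 's \<Rightarrow> (nat \<Rightarrow> 'w \<Rightarrow> 's) \<Rightarrow> bool" where
  "markov_chain M Q x X \<longleftrightarrow>
     prob_space M \<and>
     (\<forall>n. X n \<in> measurable M (count_space UNIV)) \<and>
     (\<forall>n a. measure M {\<omega> \<in> space M. \<forall>j\<le>n. X j \<omega> = a j} =
        (if a 0 = x then \<Prod>j<n. pmf (Q (a j)) (a (Suc j)) else 0))"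

text \<open>
  The law on path space of the Markov chain with transition matrix \<open>Q\<close> started at \<open>x\<close>,
  realised by independent random maps: \<open>\<xi> n y\<close> has law \<open>Q y\<close>, all the \<open>\<xi> n y\<close> are
  independent, and the chain moves from \<open>y\<close> to \<open>\<xi> n y\<close> at time \<open>n\<close>. The lemmas
  \<open>markov_chain_markov_law\<close> and \<open>markov_law_unique\<close> below show that this is the law of every
  such Markov chain.
\<close>

primrec path_of :: "(nat \<Rightarrow> 's \<Rightarrow> 's) \<Rightarrow> 's \<Rightarrow> nat \<Rightarrow> 's" where
  "path_of \<xi> x 0 = x"
| "path_of \<xi> x (Suc n) = \<xi> n (path_of \<xi> x n)"

definition markov_law :: "('s \<Rightarrow> 's pmf) \<Rightarrow> 's \<Rightarrow> (nat \<Rightarrow> 's) measure" where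
  "markov_law Q x =
     distr (\<Pi>\<^sub>M n\<in>(UNIV :: nat set). \<Pi>\<^sub>M y\<in>UNIV. measure_pmf (Q y))
           (\<Pi>\<^sub>M n\<in>UNIV. count_space UNIV) (\<lambda>\<xi>. path_of \<xi> x)"

definition return_time :: "(nat \<Rightarrow> int \<times> int) \<Rightarrow> enat" where
  "return_time p = Inf (enat ` {n. n > 0 \<and> snd (p n) = 0})"

definition property_F :: "(int \<times> int \<Rightarrow> (int \<times> int) pmf) \<Rightarrow> bool" where
  "property_F Q \<longleftrightarrow> (AE p in markov_law Q (0, 0). return_time p < \<infinity>)"

text \<open>
  The value of \<open>the_enat \<infinity>\<close> is irrelevant under \<open>property_F\<close>; \<open>\<phi>\<close> is only used there.
\<close>

definition return_position :: "(nat \<Rightarrow> int \<times> int) \<Rightarrow> int" where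
  "return_position p = fst (p (the_enat (return_time p)))"

definition \<phi> :: "(int \<times> int \<Rightarrow> (int \<times> int) pmf) \<Rightarrow> int measure" where
  "\<phi> Q = distr (markov_law Q (0, 0)) (count_space UNIV) return_position"

definition translation_invariant :: "(int \<times> int \<Rightarrow> (int \<times> int) pmf) \<Rightarrow> bool" where
  "translation_invariant Q \<longleftrightarrow>
     (\<forall>u u' v v'. pmf (Q (u, v)) (u', v') = pmf (Q (0, v)) (u' - u, v'))"

definition successfully_coupled ::
    "(int \<times> int \<Rightarrow> (int \<times> int) pmf) \<Rightarrow> (int \<times> int \<Rightarrow> (int \<times> int) pmf) \<Rightarrow> bool" where
  "successfully_coupled Q Q' \<longleftrightarrow>
     (\<exists>R :: int \<times> int \<times> int \<Rightarrow> (int \<times> int \<times> int) pmf.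
        (\<forall>u v w u' v'.
           (\<Sum>\<^sub>\<infinity>w'\<in>UNIV. pmf (R (u, v, w)) (u', v', w')) = pmf (Q' (u, v)) (u', v')) \<and>
        (\<forall>u v w u' w'.
           (\<Sum>\<^sub>\<infinity>v'\<in>UNIV. pmf (R (u, v, w)) (u', v', w')) = pmf (Q (u, w)) (u', w')) \<and>
        (\<forall>u v w u' v' w'. \<bar>w\<bar> \<le> \<bar>v\<bar> + 1 \<and> \<bar>w'\<bar> > \<bar>v'\<bar> + 1 \<longrightarrow>
           pmf (R (u, v, w)) (u', v', w') = 0))"

definition transient_process :: "'w measure \<Rightarrow> (nat \<Rightarrow> 'w \<Rightarrow> int) \<Rightarrow> bool" where
  "transient_process M S \<longleftrightarrow> (AE \<omega> in M. \<forall>x. finite {n. S n \<omega> = x})"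

definition transient_law :: "int measure \<Rightarrow> bool" where
  "transient_law P \<longleftrightarrow>
     transient_process (\<Pi>\<^sub>M n\<in>(UNIV :: nat set). P) (\<lambda>n \<omega>. \<Sum>j<n. \<omega> j)"

definition gen_sigma :: "'w measure \<Rightarrow> ('w \<Rightarrow> 'a) \<Rightarrow> 'w set set" where
  "gen_sigma M X = sets (vimage_algebra (space M) X (count_space UNIV))"

text \<open>
  \<open>history M S ix n\<close> is \<open>\<H>\<^sub>n = \<sigma>(S\<^sub>0) \<or> \<sigma>((S\<^sub>l, i(l)), 1 \<le> l \<le> n)\<close>. The value \<open>ix 0\<close> plays no
  role: the choice process is indexed from \<open>1\<close>.
\<close>

definition history ::
    "'w measure \<Rightarrow> (nat \<Rightarrow> 'w \<Rightarrow> int) \<Rightarrow> (nat \<Rightarrow> 'w \<Rightarrow> nat) \<Rightarrow> nat \<Rightarrow> 'w measure" where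
  "history M S ix n =
     sigma (space M) (gen_sigma M (S 0) \<union> (\<Union>l\<in>{1..n}. gen_sigma M (S l) \<union> gen_sigma M (ix l)))"

definition history_choice ::
    "'w measure \<Rightarrow> (nat \<Rightarrow> 'w \<Rightarrow> int) \<Rightarrow> (nat \<Rightarrow> 'w \<Rightarrow> nat) \<Rightarrow> nat \<Rightarrow> 'w measure" where
  "history_choice M S ix n =
     sigma (space M) (sets (history M S ix n) \<union> gen_sigma M (ix (Suc n)))"

text \<open>The index set \<open>{1, \<dots>, k}\<close>, which is all of \<open>{1, 2, \<dots>}\<close> for \<open>k = \<infinity>\<close>.\<close>

definition index_set :: "enat \<Rightarrow> nat set" where
  "index_set k = {i. 1 \<le> i \<and> enat i \<le> k}"

definition CL ::
    "enat \<Rightarrow> (nat \<Rightarrow> int measure) \<Rightarrow> 'w measure \<Rightarrow> (nat \<Rightarrow> 'w \<Rightarrow> int) \<Rightarrow> (nat \<Rightarrow> 'w \<Rightarrow> nat) \<Rightarrow> bool"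
  where
  "CL k P M S ix \<longleftrightarrow>
     prob_space M \<and>
     (\<forall>n. S n \<in> measurable M (count_space UNIV)) \<and>
     (\<forall>n\<ge>1. ix n \<in> measurable M (count_space UNIV)) \<and>
     (\<forall>n\<ge>1. \<forall>\<omega>\<in>space M. ix n \<omega> \<in> index_set k) \<and>
     (\<forall>n A. AE \<omega> in M.
        real_cond_exp M (history_choice M S ix n)
          (\<lambda>\<omega>. indicator A (S (Suc n) \<omega> - S n \<omega>)) \<omega>
        = measure (P (ix (Suc n) \<omega>)) A)"


lemma prob_space_map_product:
  "prob_space (\<Pi>\<^sub>M y\<in>UNIV. measure_pmf (Q y))"
  by (intro prob_space_PiM measure_pmf.prob_space_axioms)

lemma measurable_path_of [measurable]:
  fixes Q :: "'s::countable \<Rightarrow> 's pmf"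
  shows "(\<lambda>\<xi>. path_of \<xi> x n) \<in>
    measurable (\<Pi>\<^sub>M n\<in>(UNIV :: nat set). \<Pi>\<^sub>M y\<in>UNIV. measure_pmf (Q y)) (count_space UNIV)"
proof (induction n)
  case (Suc n)
  have "(\<lambda>\<xi>. \<xi> n y) \<in>
     measurable (\<Pi>\<^sub>M n\<in>(UNIV :: nat set). \<Pi>\<^sub>M y\<in>UNIV. measure_pmf (Q y)) (count_space UNIV)" for y
  proof -
    have "(\<lambda>\<xi>. \<xi> n y) \<in>
     measurable (\<Pi>\<^sub>M n\<in>(UNIV :: nat set). \<Pi>\<^sub>M y\<in>UNIV. measure_pmf (Q y)) (measure_pmf (Q y))"
      by (rule measurable_compose[where g = "\<lambda>f. f y", OF measurable_component_singleton])
         (auto intro: measurable_component_singleton)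
    then show ?thesis by (simp cong: measurable_cong_sets)
  qed
  from measurable_compose_countable[OF this Suc] show ?case by simp
qed simp

lemma sets_markov_law [measurable_cong]:
  "sets (markov_law Q x) = sets (\<Pi>\<^sub>M n\<in>UNIV. count_space UNIV)"
  by (simp add: markov_law_def)

lemma space_markov_law [simp]: "space (markov_law Q x) = UNIV"
  by (simp add: markov_law_def space_PiM)

lemma measurable_path_of_PiM:
  fixes Q :: "'s::countable \<Rightarrow> 's pmf"
  shows "(\<lambda>\<xi>. path_of \<xi> x) \<in>
    measurable (\<Pi>\<^sub>M n\<in>(UNIV :: nat set). \<Pi>\<^sub>M y\<in>UNIV. measure_pmf (Q y)) (\<Pi>\<^sub>M n\<in>UNIV. count_space UNIV)"
  by (rule measurable_PiM_single') (auto intro: measurable_path_of)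

lemma prob_space_markov_law:
  fixes Q :: "'s::countable \<Rightarrow> 's pmf"
  shows "prob_space (markov_law Q x)"
  unfolding markov_law_def
  by (intro prob_space.prob_space_distr measurable_path_of_PiM prob_space_PiM
        prob_space_map_product)

lemma markov_chain_markov_law:
  fixes Q :: "'s::countable \<Rightarrow> 's pmf"
  shows "markov_chain (markov_law Q x) Q x (\<lambda>n p. p n)"
proof -
  let ?R = "\<Pi>\<^sub>M y\<in>UNIV. measure_pmf (Q y)"
  let ?N = "\<Pi>\<^sub>M n\<in>(UNIV :: nat set). ?R"
  interpret R: prob_space ?R by (rule prob_space_map_product)
  interpret RR: product_prob_space "\<lambda>y. measure_pmf (Q y)" UNIV by unfold_locales
  interpret N: product_prob_space "\<lambda>_::nat. ?R" UNIV by unfold_locales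
  have N_space: "space ?N = UNIV" by (auto simp: space_PiM)
  have [measurable]: "(\<lambda>p. p n) \<in> measurable (markov_law Q x) (count_space UNIV)" for n
    by measurable
  have fdd: "measure (markov_law Q x) {p \<in> space (markov_law Q x). \<forall>j\<le>n. p j = a j} =
      (if a 0 = x then \<Prod>j<n. pmf (Q (a j)) (a (Suc j)) else 0)" for n a
  proof -
    let ?E = "{p \<in> space (markov_law Q x). \<forall>j\<le>n. p j = a j}"
    let ?F = "\<lambda>j. {f \<in> space ?R. f (a j) = a (Suc j)}"
    have E: "?E \<in> sets (\<Pi>\<^sub>M n\<in>UNIV. count_space UNIV)"
      unfolding sets_markov_law[symmetric, of Q x] by measurable
    have F: "?F j \<in> sets ?R" for j
      by measurable
    have eF: "measure ?R (?F j) = pmf (Q (a j)) (a (Suc j))" for j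
      using RR.emeasure_PiM_Collect[of "{a j}" "\<lambda>_. {a (Suc j)}"]
      by (simp add: pmf.rep_eq measure_def space_PiM)
    have key: "(\<forall>j\<le>n. path_of \<xi> x j = a j) \<longleftrightarrow>
        a 0 = x \<and> (\<forall>j<n. \<xi> j (a j) = a (Suc j))" for \<xi>
    proof (induction n)
      case (Suc n)
      have "(\<forall>j\<le>Suc n. path_of \<xi> x j = a j) \<longleftrightarrow>
        (\<forall>j\<le>n. path_of \<xi> x j = a j) \<and> \<xi> n (path_of \<xi> x n) = a (Suc n)"
        by (auto simp: le_Suc_eq)
      also have "\<dots> \<longleftrightarrow> (\<forall>j\<le>n. path_of \<xi> x j = a j) \<and> \<xi> n (a n) = a (Suc n)"
        by auto
      finally show ?case unfolding Suc.IH by (auto simp: less_Suc_eq)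
    qed auto
    have "measure (markov_law Q x) ?E =
        measure ?N {\<xi> \<in> space ?N. \<forall>j\<le>n. path_of \<xi> x j = a j}"
      unfolding markov_law_def
      by (subst measure_distr[OF measurable_path_of_PiM])
         (use E in \<open>auto simp: markov_law_def intro!: arg_cong[where f = "measure ?N"]
            simp: space_PiM\<close>)
    also have "\<dots> = (if a 0 = x then measure ?N {\<xi> \<in> space ?N. \<forall>j\<in>{..<n}. \<xi> j \<in> ?F j} else 0)"
      unfolding key by (simp add: space_PiM Ball_def)
    also have "measure ?N {\<xi> \<in> space ?N. \<forall>j\<in>{..<n}. \<xi> j \<in> ?F j} = (\<Prod>j<n. measure ?R (?F j))"
      using N.emeasure_PiM_Collect[of "{..<n}" ?F] F
      by (simp add: N.emeasure_eq_measure R.emeasure_eq_measure prod_ennreal prod_nonneg)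
    finally show ?thesis by (simp add: eF)
  qed
  show ?thesis
    unfolding markov_chain_def using fdd prob_space_markov_law[of Q x] by auto
qed

lemma markov_law_unique:
  fixes Q :: "'s::countable \<Rightarrow> 's pmf"
  assumes "markov_chain M Q x X"
  shows "distr M (\<Pi>\<^sub>M n\<in>UNIV. count_space UNIV) (\<lambda>\<omega> n. X n \<omega>) = markov_law Q x"
proof -
  interpret M: prob_space M using assms by (simp add: markov_chain_def)
  interpret L: prob_space "markov_law Q x" by (rule prob_space_markov_law)
  let ?P = "\<Pi>\<^sub>M n\<in>(UNIV :: nat set). count_space (UNIV :: 's set)"
  have X [measurable]: "X n \<in> measurable M (count_space UNIV)" for n
    using assms by (simp add: markov_chain_def)
  have mX: "(\<lambda>\<omega> n. X n \<omega>) \<in> measurable M ?P"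
    by (rule measurable_PiM_single') auto
  let ?D = "distr M ?P (\<lambda>\<omega> n. X n \<omega>)"
  interpret D: prob_space ?D by (rule M.prob_space_distr[OF mX])
  have cyl: "measure ?D {p. \<forall>j\<le>n. p j = a j} = measure (markov_law Q x) {p. \<forall>j\<le>n. p j = a j}"
    for n a
  proof -
    have "{p \<in> space ?P. \<forall>j\<le>n. p j = a j} \<in> sets ?P" by measurable
    then have "{p. \<forall>j\<le>n. p j = a j} \<in> sets ?P" by (simp add: space_PiM)
    then have "measure ?D {p. \<forall>j\<le>n. p j = a j} = measure M {\<omega> \<in> space M. \<forall>j\<le>n. X j \<omega> = a j}"
      by (subst measure_distr[OF mX]) (auto intro!: arg_cong[where f = "measure M"])
    also have "\<dots> = measure (markov_law Q x) {p \<in> space (markov_law Q x). \<forall>j\<le>n. p j = a j}"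
      using assms markov_chain_markov_law[of Q x] by (simp add: markov_chain_def)
    finally show ?thesis by simp
  qed
  show ?thesis
  proof (rule measure_eqI_PiM_infinite)
    show "sets ?D = sets ?P" "sets (markov_law Q x) = sets ?P"
      by (simp_all add: sets_markov_law)
    show "finite_measure ?D" by unfold_locales
    fix J :: "nat set" and A :: "nat \<Rightarrow> 's set"
    assume J: "finite J"
    obtain n where n: "J \<subseteq> {..n}" using J finite_nat_iff_bounded_le by blast
    define r :: "(nat \<Rightarrow> 's) \<Rightarrow> 's list" where "r p = map p [0..<Suc n]" for p
    have len: "length (r p) = Suc n" for p by (simp add: r_def)
    have r_nth: "r p ! j = p j" if "j \<le> n" for p j
      unfolding r_def using that nth_map_upt[of j "Suc n" 0 p] by (simp del: upt_Suc)
    have r_iff: "r p = xs \<longleftrightarrow> length xs = Suc n \<and> (\<forall>j\<le>n. p j = xs ! j)" for p xs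
    proof
      assume "r p = xs"
      then show "length xs = Suc n \<and> (\<forall>j\<le>n. p j = xs ! j)"
        using r_nth[of _ p] len[of p] by auto
    next
      assume "length xs = Suc n \<and> (\<forall>j\<le>n. p j = xs ! j)"
      then show "r p = xs"
        by (intro nth_equalityI) (simp_all add: r_nth len less_Suc_eq_le)
    qed
    have vim: "r -` {xs} = (if length xs = Suc n then {p. \<forall>j\<le>n. p j = xs ! j} else {})" for xs
      by (rule set_eqI) (simp add: r_iff)
    have r: "r \<in> measurable ?P (count_space UNIV)"
    proof (rule measurable_count_space_eq2_countable[THEN iffD2], intro conjI ballI)
      show "r \<in> space ?P \<rightarrow> UNIV" by simp
      fix xs :: "'s list"
      have "{p \<in> space ?P. \<forall>j\<le>n. p j = xs ! j} \<in> sets ?P" by measurable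
      then show "r -` {xs} \<inter> space ?P \<in> sets ?P"
        by (simp add: vim space_PiM)
    qed
    have rD: "r \<in> measurable ?D (count_space UNIV)"
      and rL: "r \<in> measurable (markov_law Q x) (count_space UNIV)"
      using r by (simp_all add: sets_markov_law cong: measurable_cong_sets)
    have S1: "B \<in> sets (count_space UNIV)" for B :: "'s list set" by simp
    have eq: "distr ?D (count_space UNIV) r = distr (markov_law Q x) (count_space UNIV) r"
    proof (rule measure_eqI_countable[where A = UNIV])
      fix xs :: "'s list"
      show "emeasure (distr ?D (count_space UNIV) r) {xs} =
            emeasure (distr (markov_law Q x) (count_space UNIV) r) {xs}"
        unfolding emeasure_distr[OF rD S1[of "{xs}"]]
          emeasure_distr[OF rL S1[of "{xs}"]]
        by (cases "length xs = Suc n")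
           (simp_all add: vim space_PiM cyl[of n "\<lambda>j. xs ! j"] D.emeasure_eq_measure L.emeasure_eq_measure)
    qed auto
    let ?B = "{xs :: 's list. \<forall>j\<in>J. xs ! j \<in> A j}"
    have emb: "prod_emb UNIV (\<lambda>_. count_space UNIV) J (Pi\<^sub>E J A) = r -` ?B"
    proof (rule set_eqI)
      fix p
      have "j \<le> n" if "j \<in> J" for j using n that by auto
      then have "p \<in> r -` ?B \<longleftrightarrow> (\<forall>j\<in>J. p j \<in> A j)" by (simp add: r_nth)
      then show "p \<in> prod_emb UNIV (\<lambda>_. count_space UNIV) J (Pi\<^sub>E J A) \<longleftrightarrow> p \<in> r -` ?B"
        by (simp add: prod_emb_iff PiE_iff)
    qed
    have "emeasure (distr ?D (count_space UNIV) r) ?B =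
          emeasure (distr (markov_law Q x) (count_space UNIV) r) ?B"
      by (simp only: eq)
    then show "emeasure ?D (prod_emb UNIV (\<lambda>_. count_space UNIV) J (Pi\<^sub>E J A)) =
          emeasure (markov_law Q x) (prod_emb UNIV (\<lambda>_. count_space UNIV) J (Pi\<^sub>E J A))"
      unfolding emb
      unfolding emeasure_distr[OF rD S1[of ?B]]
        emeasure_distr[OF rL S1[of ?B]]
      by (simp add: space_PiM)
  qed
qed

lemma return_time_eq_enat_iff:
  "return_time p = enat n \<longleftrightarrow>
     0 < n \<and> snd (p n) = 0 \<and> (\<forall>m<n. \<not> (0 < m \<and> snd (p m) = 0))"
proof (cases "\<exists>n. 0 < n \<and> snd (p n) = 0")
  case True
  let ?A = "{n. n > 0 \<and> snd (p n) = 0}"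
  define l where "l = (LEAST n. n \<in> ?A)"
  have "\<exists>n. n \<in> ?A" using True by simp
  from LeastI_ex[OF this] have l: "l \<in> ?A" "\<And>m. m \<in> ?A \<Longrightarrow> l \<le> m"
    by (simp_all only: l_def Least_le)
  have "return_time p = enat l"
    unfolding return_time_def
    by (rule antisym) (use l in \<open>auto intro!: Inf_lower Inf_greatest\<close>)
  moreover have "l = n \<longleftrightarrow> n \<in> ?A \<and> (\<forall>m<n. m \<notin> ?A)"
    using l by (meson leD le_neq_implies_less)
  ultimately show ?thesis by simp
next
  case False
  then have "{n. n > 0 \<and> snd (p n) = 0} = {}" by auto
  then have "return_time p = \<infinity>" unfolding return_time_def by (simp only: image_empty Inf_enat_def) auto
  with False show ?thesis by auto
qed

lemma measurable_return_time [measurable]: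
  "return_time \<in> measurable (\<Pi>\<^sub>M n\<in>UNIV. count_space UNIV) (count_space UNIV)"
proof -
  let ?P = "\<Pi>\<^sub>M n\<in>(UNIV :: nat set). count_space (UNIV :: (int \<times> int) set)"
  have Z: "{p \<in> space ?P. snd (p m) = 0} \<in> sets ?P" for m
  proof -
    have "(\<lambda>p. p m) \<in> measurable ?P (count_space UNIV)" by simp
    from measurable_sets[OF this, of "{z. snd z = 0}"] show ?thesis
      by (simp add: vimage_def Int_def conj_commute)
  qed
  have enat: "return_time -` {enat n} \<inter> space ?P \<in> sets ?P" for n
  proof -
    let ?Z = "\<lambda>m. {p \<in> space ?P. snd (p m) = 0}"
    have "return_time -` {enat n} \<inter> space ?P =
        (if 0 < n then ?Z n - (\<Union>m\<in>{0<..<n}. ?Z m) else {})"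
      by (auto simp: return_time_eq_enat_iff)
    also have "\<dots> \<in> sets ?P"
      using Z by (simp add: sets.Diff sets.finite_UN)
    finally show ?thesis .
  qed
  have inf: "return_time -` {\<infinity>} \<inter> space ?P \<in> sets ?P"
  proof -
    have "return_time -` {\<infinity>} \<inter> space ?P = space ?P - (\<Union>n. return_time -` {enat n} \<inter> space ?P)"
      by (auto simp: not_infinity_eq)
    also have "\<dots> \<in> sets ?P" using enat by blast
    finally show ?thesis .
  qed
  show ?thesis
  proof (rule measurable_count_space_eq2_countable[THEN iffD2], intro conjI ballI)
    fix t :: enat
    show "return_time -` {t} \<inter> space ?P \<in> sets ?P" using enat inf by (cases t) auto
  qed auto
qed

lemma measurable_return_position [measurable]:
  "return_position \<in> measurable (\<Pi>\<^sub>M n\<in>UNIV. count_space UNIV) (count_space UNIV)"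
  unfolding return_position_def
proof (rule measurable_compose_countable[where g = return_time, OF _ measurable_return_time])
  fix t :: enat
  have "(\<lambda>p. p (the_enat t)) \<in>
      measurable (\<Pi>\<^sub>M n\<in>(UNIV :: nat set). count_space (UNIV :: (int \<times> int) set)) (count_space UNIV)"
    by simp
  then show "(\<lambda>p. fst (p (the_enat t))) \<in>
      measurable (\<Pi>\<^sub>M n\<in>(UNIV :: nat set). count_space (UNIV :: (int \<times> int) set)) (count_space UNIV)"
    by (rule measurable_compose) simp
qed

lemma prob_space_phi: "prob_space (\<phi> Q)"
  unfolding \<phi>_def
  by (intro prob_space.prob_space_distr prob_space_markov_law)
     (simp add: measurable_return_position sets_markov_law cong: measurable_cong_sets)

text \<open>Property (F) and \<open>\<phi>\<close> can be computed from any Markov chain with the given matrix.\<close>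

lemma property_F_iff:
  assumes "markov_chain M Q (0, 0) X"
  shows "property_F Q \<longleftrightarrow> (AE \<omega> in M. return_time (\<lambda>n. X n \<omega>) < \<infinity>)"
proof -
  let ?P = "\<Pi>\<^sub>M n\<in>(UNIV :: nat set). count_space (UNIV :: (int \<times> int) set)"
  have mX: "(\<lambda>\<omega> n. X n \<omega>) \<in> measurable M ?P"
    using assms by (intro measurable_PiM_single') (auto simp: markov_chain_def)
  have "{p \<in> space ?P. return_time p < \<infinity>} \<in> sets ?P" by measurable
  then show ?thesis
    unfolding property_F_def markov_law_unique[OF assms, symmetric] by (rule AE_distr_iff[OF mX])
qed

lemma phi_eq:
  assumes "markov_chain M Q (0, 0) X"
  shows "\<phi> Q = distr M (count_space UNIV) (\<lambda>\<omega>. return_position (\<lambda>n. X n \<omega>))"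
proof -
  let ?P = "\<Pi>\<^sub>M n\<in>(UNIV :: nat set). count_space (UNIV :: (int \<times> int) set)"
  have mX: "(\<lambda>\<omega> n. X n \<omega>) \<in> measurable M ?P"
    using assms by (intro measurable_PiM_single') (auto simp: markov_chain_def)
  show ?thesis
    unfolding \<phi>_def markov_law_unique[OF assms, symmetric]
    by (subst distr_distr[OF measurable_return_position mX]) (simp add: comp_def)
qed

text \<open>The conditional expectations in \<open>CL\<close> are taken with respect to genuine sub-\<open>\<sigma>\<close>-algebras.\<close>

lemma gen_sigma_subset:
  "X \<in> measurable M (count_space UNIV) \<Longrightarrow> gen_sigma M X \<subseteq> sets M"
  unfolding gen_sigma_def by (auto simp: sets_vimage_algebra2 intro: measurable_sets)

lemma subalgebra_history_choice:
  assumes "CL k P M S ix"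
  shows "subalgebra M (history_choice M S ix n)"
proof -
  have S: "gen_sigma M (S l) \<subseteq> sets M" for l
    using assms by (intro gen_sigma_subset) (simp add: CL_def)
  have I: "gen_sigma M (ix l) \<subseteq> sets M" if "l \<ge> 1" for l
    using assms that by (intro gen_sigma_subset) (simp add: CL_def)
  let ?G = "gen_sigma M (S 0) \<union> (\<Union>l\<in>{1..n}. gen_sigma M (S l) \<union> gen_sigma M (ix l))"
  have G: "?G \<subseteq> sets M"
    by (intro Un_least UN_least S I) simp
  have "?G \<subseteq> Pow (space M)" using G sets.space_closed[of M] by (rule subset_trans)
  then have "sets (history M S ix n) = sigma_sets (space M) ?G"
    unfolding history_def by (rule sets_measure_of)
  with sets.sigma_sets_subset[OF G] have "sets (history M S ix n) \<subseteq> sets M" by (simp only:)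
  then have H: "sets (history M S ix n) \<union> gen_sigma M (ix (Suc n)) \<subseteq> sets M" (is "?H \<subseteq> _")
    by (rule Un_least) (rule I, simp)
  have "?H \<subseteq> Pow (space M)" using H sets.space_closed[of M] by (rule subset_trans)
  then have "sets (history_choice M S ix n) = sigma_sets (space M) ?H"
    unfolding history_choice_def by (rule sets_measure_of)
  with sets.sigma_sets_subset[OF H] have "sets (history_choice M S ix n) \<subseteq> sets M" by (simp only:)
  then show ?thesis
    unfolding subalgebra_def by (simp add: history_choice_def space_measure_of_conv)
qed

end

theory Submission
  imports Defs
begin

text \<open>
  Fix a site \<open>x\<close>. The proof bounds the expected number of visits to \<open>x\<close> by exhibiting one
  nonnegative function \<open>h\<close> on \<open>\<int>\<close> that is finite and superharmonic for all the laws \<open>P\<^sub>i\<close> at once,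
  with a drop of at least \<open>1\<close> at \<open>x\<close>:
  \<open>h(u) \<ge> 1\<^bsub>{u = x}\<^esub> + \<Sum>\<^sub>z P\<^sub>i(z) h(u + z)\<close> for every \<open>i\<close>. Whatever the rule that chooses the laws, \<open>h(S\<^sub>n)\<close> then
  decreases on average and every visit to \<open>x\<close> costs at least \<open>1\<close>, so that the expected number of
  visits from \<open>S\<^sub>0 = s\<close> is at most \<open>h(s)\<close> (lemma \<open>CL_expected_visits_le\<close>), and the Borel-Cantelli
  lemma gives transience.

  The function comes from the chain \<open>(U, W)\<close> with matrix \<open>Q\<^sub>0\<close>. Let \<open>H(u, w)\<close> be the expected time
  that this chain, started at \<open>(u, w)\<close>, spends in the strip \<open>{x} \<times> {-1, 0, 1}\<close>, and put
  \<open>h(u) = min {H(u, w) | w = -1, 0, 1}\<close>. Start the coupled chain \<open>(U, V, W)\<close> at \<open>(u, 0, w)\<close> with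
  \<open>\<bar>w\<bar> \<le> 1\<close>. The coupling preserves \<open>\<bar>W\<bar> \<le> \<bar>V\<bar> + 1\<close>, so when \<open>V\<close> first returns to \<open>0\<close>, the second
  component \<open>W\<close> is again in \<open>{-1, 0, 1}\<close>. Meanwhile \<open>H(U, W)\<close> is a supermartingale, and
  \<open>(U, V)\<close> has matrix \<open>Q\<^sub>i\<close>, so \<open>U\<close> has made one step of law \<open>P\<^sub>i\<close>. Hence the average of \<open>h\<close> after
  such a step is at most \<open>H(u, w)\<close>, less the contribution of time \<open>0\<close>
  (lemma \<open>strip_Inf_superharmonic\<close>). The minimum over \<open>w\<close> forgets the position of \<open>W\<close>, which is why
  a single function of \<open>u\<close> serves all the couplings, in whatever order the laws are used.

  It remains to see that \<open>H(s, 0)\<close> is finite, that is, that \<open>Q\<^sub>0\<close> visits each point of the strip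
  finitely often in expectation. On the axis \<open>w = 0\<close> the chain performs the random walk with law
  \<open>P\<^sub>0\<close>, whose Green function is finite by a last exit decomposition (lemma \<open>walk_green_finite\<close>).
  A point off the axis is either never visited, or the chain, which by (F) always comes back, can
  reach the axis from it; each visit then yields a fixed positive expected number of visits to some
  point of the axis (lemma \<open>potential_point_finite\<close>).
\<close>

section \<open>Potentials of transition matrices\<close>

definition step_op :: "('s \<Rightarrow> 's pmf) \<Rightarrow> ('s \<Rightarrow> ennreal) \<Rightarrow> 's \<Rightarrow> ennreal" where
  "step_op Q f x = (\<integral>\<^sup>+ y. f y \<partial>measure_pmf (Q x))"

text \<open>The expected total of \<open>g\<close> along the chain, with values in \<open>[0, \<infinity>]\<close>.\<close>

definition potential :: "('s \<Rightarrow> 's pmf) \<Rightarrow> ('s \<Rightarrow> ennreal) \<Rightarrow> 's \<Rightarrow> ennreal" where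
  "potential Q g x = (\<Sum>n. (step_op Q ^^ n) g x)"

lemma step_op_mono: "(\<And>y. y \<in> set_pmf (Q x) \<Longrightarrow> f y \<le> g y) \<Longrightarrow> step_op Q f x \<le> step_op Q g x"
  unfolding step_op_def by (intro nn_integral_mono_AE) (simp add: AE_measure_pmf_iff)

lemma step_op_power_mono: "(\<And>y. f y \<le> g y) \<Longrightarrow> (step_op Q ^^ n) f x \<le> (step_op Q ^^ n) g x"
  by (induction n arbitrary: x) (auto intro: step_op_mono)

lemma step_op_power_cmult: "(step_op Q ^^ n) (\<lambda>y. c * f y) x = c * (step_op Q ^^ n) f x"
  by (induction n arbitrary: x) (simp_all add: step_op_def nn_integral_cmult)

lemma step_op_power_add:
  "(step_op Q ^^ n) (\<lambda>y. f y + g y) x = (step_op Q ^^ n) f x + (step_op Q ^^ n) g x"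
  by (induction n arbitrary: x) (simp_all add: step_op_def nn_integral_add)

lemma potential_add: "potential Q (\<lambda>y. f y + g y) x = potential Q f x + potential Q g x"
  unfolding potential_def step_op_power_add by (intro suminf_add[symmetric]) simp_all

lemma potential_unfold: "potential Q g x = g x + step_op Q (potential Q g) x"
proof -
  have "potential Q g x = (\<Sum>n. (step_op Q ^^ (n + 1)) g x) + (\<Sum>n<1. (step_op Q ^^ n) g x)"
    unfolding potential_def by (rule suminf_offset) simp
  also have "(\<Sum>n. (step_op Q ^^ (n + 1)) g x) = step_op Q (potential Q g) x"
    unfolding potential_def step_op_def by (simp add: nn_integral_suminf step_op_def)
  finally show ?thesis by (simp add: add.commute)
qed

text \<open>
  Iterating the hypothesis bounds every partial sum of the potential by \<open>f\<close>: this is the half of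
  the minimality of potentials that turns a superharmonic function into a bound on expected
  occupation times.
\<close>

lemma potential_le_superharmonic:
  assumes "\<And>y. g y + step_op Q f y \<le> f y"
  shows "potential Q g x \<le> f x"
proof -
  have partial: "(\<Sum>n<N. (step_op Q ^^ n) g x) + (step_op Q ^^ N) f x \<le> f x" for N
  proof (induction N)
    case (Suc N)
    have "(step_op Q ^^ N) g x + (step_op Q ^^ Suc N) f x
        = (step_op Q ^^ N) (\<lambda>y. g y + step_op Q f y) x"
      by (simp add: step_op_power_add funpow_swap1)
    also have "\<dots> \<le> (step_op Q ^^ N) f x" by (rule step_op_power_mono) (rule assms)
    finally have "(\<Sum>n<Suc N. (step_op Q ^^ n) g x) + (step_op Q ^^ Suc N) f x
        \<le> (\<Sum>n<N. (step_op Q ^^ n) g x) + (step_op Q ^^ N) f x"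
      by (simp add: add.assoc add_left_mono del: funpow.simps)
    with Suc show ?case by (rule order_trans[rotated])
  qed simp
  have "(\<Sum>n<N. (step_op Q ^^ n) g x) \<le> f x" for N
    by (rule order_trans[OF _ partial[of N]]) simp
  then show ?thesis unfolding potential_def by (intro suminf_le_const) simp_all
qed

text \<open>
  Each visit to \<open>a\<close> contributes \<open>(Q\<^sup>m g)(a)\<close> to the expected total of \<open>g\<close>, so a state from which
  the chain can reach the support of \<open>g\<close> has a finite Green function wherever the potential
  of \<open>g\<close> is finite.
\<close>

lemma potential_indicator_finite:
  assumes pos: "(step_op Q ^^ m) g a > 0" and fin: "potential Q g x < \<infinity>"
  shows "potential Q (indicator {a}) x < \<infinity>"
proof -
  let ?c = "(step_op Q ^^ m) g a"
  have "?c * potential Q (indicator {a}) x = (\<Sum>n. (step_op Q ^^ n) (\<lambda>y. ?c * indicator {a} y) x)"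
    unfolding potential_def step_op_power_cmult by simp
  also have "\<dots> \<le> (\<Sum>n. (step_op Q ^^ n) ((step_op Q ^^ m) g) x)"
    by (intro suminf_le step_op_power_mono) (auto simp: indicator_def)
  also have "\<dots> = (\<Sum>n. (step_op Q ^^ (n + m)) g x)" by (simp add: funpow_add)
  also have "\<dots> \<le> potential Q g x"
    unfolding potential_def
    by (subst suminf_offset[of "\<lambda>n. (step_op Q ^^ n) g x" m]) simp_all
  finally have "?c * potential Q (indicator {a}) x < \<infinity>" using fin by (rule le_less_trans)
  with pos show ?thesis by (auto simp: ennreal_mult_less_top)
qed

section \<open>The return to the axis, one step at a time\<close>

text \<open>
  The expectation of \<open>h (U\<^sub>T)\<close> on the event \<open>T \<le> m\<close>. The starting point itself is never
  counted as a return, as in the definition of the return time.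
\<close>

primrec return_value ::
    "(int \<times> int \<Rightarrow> (int \<times> int) pmf) \<Rightarrow> (int \<Rightarrow> ennreal) \<Rightarrow> nat \<Rightarrow> int \<times> int \<Rightarrow> ennreal" where
  "return_value Q h 0 = (\<lambda>_. 0)"
| "return_value Q h (Suc m) =
     step_op Q (\<lambda>y. if snd y = 0 then h (fst y) else return_value Q h m y)"

definition return_limit ::
    "(int \<times> int \<Rightarrow> (int \<times> int) pmf) \<Rightarrow> (int \<Rightarrow> ennreal) \<Rightarrow> int \<times> int \<Rightarrow> ennreal" where
  "return_limit Q h x = (SUP m. return_value Q h m x)"

lemma return_value_Suc_mono: "return_value Q h m x \<le> return_value Q h (Suc m) x"
proof (induction m arbitrary: x)
  case (Suc m)
  show ?case
    unfolding return_value.simps(2)[of Q h m] return_value.simps(2)[of Q h "Suc m"]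
    by (rule step_op_mono) (use Suc in auto)
qed simp

lemma incseq_return_value: "incseq (return_value Q h)"
  by (intro incseq_SucI le_funI return_value_Suc_mono)

lemma return_limit_unfold:
  "return_limit Q h x = step_op Q (\<lambda>y. if snd y = 0 then h (fst y) else return_limit Q h y) x"
proof -
  let ?f = "\<lambda>m y. if snd y = 0 then h (fst y) else return_value Q h m y"
  have inc: "incseq ?f"
    using incseq_return_value[of Q h] by (auto simp: incseq_def le_fun_def)
  have "return_limit Q h x = (SUP m. return_value Q h (Suc m) x)"
    unfolding return_limit_def
    by (intro antisym SUP_mono) (blast intro: return_value_Suc_mono)+
  also have "\<dots> = step_op Q (\<lambda>y. SUP m. ?f m y) x"
    unfolding return_value.simps step_op_def
    by (rule nn_integral_monotone_convergence_SUP[symmetric, OF inc]) simp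
  also have "(\<lambda>y. SUP m. ?f m y) = (\<lambda>y. if snd y = 0 then h (fst y) else return_limit Q h y)"
    by (auto simp: fun_eq_iff return_limit_def)
  finally show ?thesis .
qed

lemma translation_invariant_map_pmf:
  assumes "translation_invariant Q"
  shows "Q (a + u, v) = map_pmf (\<lambda>(x, y). (a + x, y)) (Q (u, v))"
proof (rule pmf_eqI)
  fix z :: "int \<times> int"
  obtain x y where z: "z = (x, y)" by fastforce
  have "inj (\<lambda>(x, y). (a + x, y :: int))" by (auto simp: inj_on_def)
  from pmf_map_inj'[OF this, of "Q (u, v)" "(x - a, y)"]
  have "pmf (map_pmf (\<lambda>(x, y). (a + x, y)) (Q (u, v))) z = pmf (Q (u, v)) (x - a, y)"
    by (simp add: z)
  also have "\<dots> = pmf (Q (0, v)) (x - a - u, y)"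
    using assms unfolding translation_invariant_def by blast
  also have "\<dots> = pmf (Q (a + u, v)) z"
    using assms unfolding translation_invariant_def z by (metis diff_diff_eq)
  finally show "pmf (Q (a + u, v)) z = pmf (map_pmf (\<lambda>(x, y). (a + x, y)) (Q (u, v))) z" ..
qed

lemma return_value_translate:
  assumes "translation_invariant Q"
  shows "return_value Q h m (a + u, v) = return_value Q (\<lambda>z. h (a + z)) m (u, v)"
proof (induction m arbitrary: u v)
  case (Suc m)
  show ?case
    unfolding return_value.simps step_op_def translation_invariant_map_pmf[OF assms, of a]
      nn_integral_map_pmf
    by (intro nn_integral_cong) (auto simp: Suc)
qed simp

text \<open>
  The Markov property at time \<open>1\<close>, read off the construction by random maps: the map used at
  time \<open>0\<close> is evaluated at the deterministic point \<open>x\<close> only, so its value has law \<open>Q x\<close>, and the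
  later maps are an independent family with the same law as the whole.
\<close>

lemma nn_integral_markov_law:
  fixes Q :: "'s::countable \<Rightarrow> 's pmf"
  assumes [measurable]: "F \<in> borel_measurable (\<Pi>\<^sub>M n\<in>(UNIV :: nat set). count_space UNIV)"
  shows "(\<integral>\<^sup>+ p. F p \<partial>markov_law Q x) =
    (\<integral>\<^sup>+ y. (\<integral>\<^sup>+ p. F (case_nat x p) \<partial>markov_law Q y) \<partial>measure_pmf (Q x))"
proof -
  let ?R = "\<Pi>\<^sub>M y\<in>UNIV. measure_pmf (Q y)"
  let ?N = "\<Pi>\<^sub>M n\<in>(UNIV :: nat set). ?R"
  let ?P = "\<Pi>\<^sub>M n\<in>(UNIV :: nat set). count_space (UNIV :: 's set)"
  interpret R: prob_space ?R by (rule prob_space_map_product)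
  interpret RR: product_prob_space "\<lambda>y. measure_pmf (Q y)" UNIV by unfold_locales
  interpret N: sequence_space ?R by unfold_locales
  note mp[measurable] = measurable_path_of_PiM[of _ Q]
  have path: "path_of (case_nat f \<xi>) x = case_nat x (path_of \<xi> (f x))" for f :: "'s \<Rightarrow> 's" and \<xi>
  proof
    fix n
    show "path_of (case_nat f \<xi>) x n = case_nat x (path_of \<xi> (f x)) n"
    proof (induction n)
      case (Suc n) then show ?case by (cases n) simp_all
    qed simp
  qed
  have [measurable]: "(\<lambda>p. case_nat x p) \<in> measurable ?P ?P" by measurable
  have [measurable]: "(\<lambda>\<xi>. F (path_of \<xi> x)) \<in> borel_measurable ?N"
    by measurable
  have [measurable]: "(\<lambda>(f, \<xi>). case_nat f \<xi>) \<in> measurable (?R \<Otimes>\<^sub>M ?N) ?N" by measurable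
  have comp: "distr ?R (measure_pmf (Q x)) (\<lambda>f. f x) = measure_pmf (Q x)"
    by (rule RR.PiM_component) simp
  have "(\<integral>\<^sup>+ p. F p \<partial>markov_law Q x) = (\<integral>\<^sup>+ \<xi>. F (path_of \<xi> x) \<partial>?N)"
    unfolding markov_law_def by (rule nn_integral_distr) measurable
  also have "\<dots> = (\<integral>\<^sup>+ \<xi>. F (path_of \<xi> x) \<partial>distr (?R \<Otimes>\<^sub>M ?N) ?N (\<lambda>(f, \<xi>). case_nat f \<xi>))"
    by (simp only: N.PiM_iter)
  also have "\<dots> = (\<integral>\<^sup>+ z. F (path_of (case_nat (fst z) (snd z)) x) \<partial>(?R \<Otimes>\<^sub>M ?N))"
    by (subst nn_integral_distr) (simp_all add: case_prod_beta)
  also have "\<dots> = (\<integral>\<^sup>+ f. \<integral>\<^sup>+ \<xi>. F (path_of (case_nat f \<xi>) x) \<partial>?N \<partial>?R)"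
    by (subst sigma_finite_measure.nn_integral_fst[symmetric])
       (simp_all add: prob_space_imp_sigma_finite prob_space_PiM prob_space_map_product)
  also have "\<dots> = (\<integral>\<^sup>+ f. \<integral>\<^sup>+ \<xi>. F (case_nat x (path_of \<xi> (f x))) \<partial>?N \<partial>?R)"
    by (simp only: path)
  also have "\<dots> = (\<integral>\<^sup>+ f. \<integral>\<^sup>+ p. F (case_nat x p) \<partial>markov_law Q (f x) \<partial>?R)"
    unfolding markov_law_def by (subst nn_integral_distr) simp_all
  also have "\<dots> = (\<integral>\<^sup>+ y. (\<integral>\<^sup>+ p. F (case_nat x p) \<partial>markov_law Q y)
      \<partial>distr ?R (measure_pmf (Q x)) (\<lambda>f. f x))"
    by (subst nn_integral_distr) simp_all
  finally show ?thesis unfolding comp .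
qed

lemma return_time_case_nat:
  "return_time (case_nat x p) = (if snd (p 0) = 0 then 1 else eSuc (return_time p))"
proof (cases "snd (p 0) = 0")
  case True
  then have "return_time (case_nat x p) = enat 1"
    by (subst return_time_eq_enat_iff) simp
  with True show ?thesis by (simp add: one_enat_def)
next
  case False
  have "return_time (case_nat x p) = enat m \<longleftrightarrow> eSuc (return_time p) = enat m" for m
  proof (cases m)
    case 0
    have "return_time (case_nat x p) \<noteq> enat 0" by (simp add: return_time_eq_enat_iff del: enat_0)
    with 0 show ?thesis by (simp add: zero_enat_def[symmetric])
  next
    case (Suc j)
    have "eSuc (return_time p) = enat m \<longleftrightarrow> return_time p = enat j"
      by (simp add: Suc eSuc_enat[symmetric])
    also have "\<dots> \<longleftrightarrow> return_time (case_nat x p) = enat m"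
      unfolding return_time_eq_enat_iff Suc using False
      by (auto simp: less_Suc_eq_0_disj all_conj_distrib gr0_conv_Suc split: nat.splits)
        (metis less_Suc_eq_0_disj not0_implies_Suc)+
    finally show ?thesis ..
  qed
  then have "return_time (case_nat x p) = eSuc (return_time p)"
    by (metis not_enat_eq)
  with False show ?thesis by simp
qed

lemma AE_markov_law_start:
  fixes Q :: "'s::countable \<Rightarrow> 's pmf"
  shows "AE p in markov_law Q x. p 0 = x"
  unfolding markov_law_def
  by (subst AE_distr_iff[OF measurable_path_of_PiM]) simp_all

lemma return_value_eq_nn_integral:
  "return_value Q h m x =
    (\<integral>\<^sup>+ p. (if return_time p \<le> enat m then h (return_position p) else 0) \<partial>markov_law Q x)"
proof (induction m arbitrary: x)
  case 0
  have "\<not> return_time p \<le> enat 0" for p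
    using return_time_eq_enat_iff[of p 0] by (simp add: zero_enat_def[symmetric])
  then show ?case by simp
next
  case (Suc m)
  let ?F = "\<lambda>m p. if return_time p \<le> enat m then h (return_position p) else 0"
  have shift: "?F (Suc m) (case_nat x p) = (if snd (p 0) = 0 then h (fst (p 0)) else ?F m p)" for p
  proof (cases "return_time p")
    case (enat n)
    then show ?thesis
      by (auto simp: return_position_def return_time_case_nat one_enat_def eSuc_enat)
  next
    case infinity
    then show ?thesis
      by (auto simp: return_position_def return_time_case_nat one_enat_def)
  qed
  have [measurable]: "?F m \<in> borel_measurable (\<Pi>\<^sub>M n\<in>(UNIV :: nat set). count_space UNIV)" for m
    by measurable
  have "(\<integral>\<^sup>+ p. ?F (Suc m) p \<partial>markov_law Q x)
      = (\<integral>\<^sup>+ y. (\<integral>\<^sup>+ p. (if snd (p 0) = 0 then h (fst (p 0)) else ?F m p) \<partial>markov_law Q y)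
          \<partial>measure_pmf (Q x))"
    by (subst nn_integral_markov_law) (simp_all only: shift, measurable)
  also have "\<dots> = (\<integral>\<^sup>+ y. (if snd y = 0 then h (fst y) else return_value Q h m y) \<partial>measure_pmf (Q x))"
  proof (rule nn_integral_cong)
    fix y
    interpret L: prob_space "markov_law Q y" by (rule prob_space_markov_law)
    have "(\<integral>\<^sup>+ p. (if snd (p 0) = 0 then h (fst (p 0)) else ?F m p) \<partial>markov_law Q y)
       = (\<integral>\<^sup>+ p. (if snd y = 0 then h (fst y) else ?F m p) \<partial>markov_law Q y)"
      using AE_markov_law_start[of y Q] by (intro nn_integral_cong_AE) (auto elim: eventually_mono)
    also have "\<dots> = (if snd y = 0 then h (fst y) else return_value Q h m y)"
      using L.emeasure_space_1 by (simp add: Suc)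
    finally show "(\<integral>\<^sup>+ p. (if snd (p 0) = 0 then h (fst (p 0)) else ?F m p) \<partial>markov_law Q y) = \<dots>" .
  qed
  finally show ?case by (simp add: step_op_def)
qed

text \<open>Property (F) ensures that no mass is lost when \<open>m\<close> tends to infinity; translation invariance
  moves the starting point from the origin to \<open>(u, 0)\<close>.\<close>

lemma nn_integral_phi:
  assumes "translation_invariant Q" "property_F Q"
  shows "(\<integral>\<^sup>+ z. h (u + z) \<partial>\<phi> Q) = return_limit Q h (u, 0)"
proof -
  let ?F = "\<lambda>m p. if return_time p \<le> enat m then h (u + return_position p) else 0"
  have [measurable]: "?F m \<in> borel_measurable (markov_law Q (0,0))" for m
    unfolding measurable_cong_sets[OF sets_markov_law refl] by measurable
  have [measurable]: "return_position \<in> measurable (markov_law Q (0,0)) (count_space UNIV)"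
    unfolding measurable_cong_sets[OF sets_markov_law refl] by measurable
  have "(\<integral>\<^sup>+ z. h (u + z) \<partial>\<phi> Q) = (\<integral>\<^sup>+ p. h (u + return_position p) \<partial>markov_law Q (0,0))"
    unfolding \<phi>_def by (subst nn_integral_distr) simp_all
  also have "\<dots> = (\<integral>\<^sup>+ p. (SUP m. ?F m p) \<partial>markov_law Q (0,0))"
  proof (rule nn_integral_cong_AE)
    show "AE p in markov_law Q (0,0). h (u + return_position p) = (SUP m. ?F m p)"
      using assms(2) unfolding property_F_def
    proof (rule eventually_mono)
      fix p :: "nat \<Rightarrow> int \<times> int" assume "return_time p < \<infinity>"
      then obtain n where n: "return_time p = enat n" by auto
      show "h (u + return_position p) = (SUP m. ?F m p)"
      proof (rule antisym)
        show "h (u + return_position p) \<le> (SUP m. ?F m p)"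
          by (rule SUP_upper2[where i = n]) (simp_all add: n)
      qed (rule SUP_least, simp)
    qed
  qed
  also have "\<dots> = (SUP m. (\<integral>\<^sup>+ p. ?F m p \<partial>markov_law Q (0,0)))"
  proof (rule nn_integral_monotone_convergence_SUP)
    show "incseq ?F"
      by (auto simp: incseq_def le_fun_def intro: order_trans)
  qed simp
  also have "\<dots> = return_limit Q h (u, 0)"
    using return_value_translate[OF assms(1), of h _ u 0 0]
    by (simp add: return_limit_def return_value_eq_nn_integral)
  finally show ?thesis .
qed

section \<open>The Green function of a transient random walk\<close>

text \<open>The expected number of visits to \<open>x\<close> of the walk with step law \<open>P\<close> started at \<open>u\<close>.\<close>

definition walk_green :: "int measure \<Rightarrow> int \<Rightarrow> int \<Rightarrow> ennreal" where
  "walk_green P x u =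
     (\<Sum>n. emeasure (\<Pi>\<^sub>M j\<in>(UNIV :: nat set). P) {\<omega>. u + (\<Sum>j<n. \<omega> j) = x})"

context
  fixes P :: "int measure"
  assumes prob: "prob_space P" and sets_P: "sets P = UNIV"
begin

private abbreviation "\<Omega> \<equiv> \<Pi>\<^sub>M j\<in>(UNIV :: nat set). P"

interpretation P: prob_space P by (rule prob)
interpretation SS: sequence_space P by unfold_locales

lemma space_P: "space P = UNIV"
  using sets_P sets.sets_into_space[of UNIV P] by auto

lemma space_walk_space: "space \<Omega> = UNIV"
  by (simp add: space_PiM space_P)

lemma measurable_partial_sum: "(\<lambda>\<omega>. \<Sum>j<n. \<omega> j) \<in> measurable \<Omega> (count_space UNIV)"
proof (induction n)
  case (Suc n)
  have "(\<lambda>\<omega>. \<omega> n) \<in> measurable \<Omega> P" by simp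
  moreover have "(\<lambda>z. i + z) \<in> measurable P (count_space UNIV)" for i
    by (simp add: measurable_def space_P sets_P)
  ultimately have "(\<lambda>\<omega>. i + \<omega> n) \<in> measurable \<Omega> (count_space UNIV)" for i
    by (rule measurable_compose)
  from measurable_compose_countable[OF this Suc] show ?case by simp
qed simp

lemma sets_partial_sum: "{\<omega>. Pr (\<Sum>j<n. \<omega> j)} \<in> sets \<Omega>"
  using measurable_sets[OF measurable_partial_sum, of "{s. Pr s}" n]
  by (simp add: vimage_def space_walk_space)

lemma walk_green_unfold:
  "walk_green P x u = indicator {x} u + (\<integral>\<^sup>+ z. walk_green P x (u + z) \<partial>P)"
proof -
  let ?E = "\<lambda>u n. {\<omega> :: nat \<Rightarrow> int. u + (\<Sum>j<n. \<omega> j) = x}"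
  have E: "?E u n \<in> sets \<Omega>" for u n by (rule sets_partial_sum)
  have step: "emeasure \<Omega> (?E u (Suc n)) = (\<integral>\<^sup>+ z. emeasure \<Omega> (?E (u + z) n) \<partial>P)" for n
  proof -
    let ?c = "\<lambda>(z :: int, \<omega>). case_nat z \<omega>"
    have c: "?c \<in> measurable (P \<Otimes>\<^sub>M \<Omega>) \<Omega>" by measurable
    have "emeasure \<Omega> (?E u (Suc n)) = emeasure (distr (P \<Otimes>\<^sub>M \<Omega>) \<Omega> ?c) (?E u (Suc n))"
      by (simp only: SS.PiM_iter)
    also have "\<dots> = emeasure (P \<Otimes>\<^sub>M \<Omega>) (?c -` ?E u (Suc n) \<inter> space (P \<Otimes>\<^sub>M \<Omega>))"
      by (rule emeasure_distr[OF c E])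
    also have "\<dots> = (\<integral>\<^sup>+ z. emeasure \<Omega> (Pair z -` (?c -` ?E u (Suc n) \<inter> space (P \<Otimes>\<^sub>M \<Omega>))) \<partial>P)"
      by (rule SS.P.emeasure_pair_measure_alt) (rule measurable_sets[OF c E])
    also have "\<dots> = (\<integral>\<^sup>+ z. emeasure \<Omega> (?E (u + z) n) \<partial>P)"
      by (intro nn_integral_cong arg_cong[where f = "emeasure \<Omega>"])
         (auto simp: space_pair_measure space_P space_walk_space sum.lessThan_Suc_shift
           simp del: sum.lessThan_Suc)
    finally show ?thesis .
  qed
  have "walk_green P x u = (\<Sum>n. emeasure \<Omega> (?E u (n + 1))) + (\<Sum>n<1. emeasure \<Omega> (?E u n))"
    unfolding walk_green_def by (rule suminf_offset) simp
  also have "(\<Sum>n<1. emeasure \<Omega> (?E u n)) = indicator {x} u"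
    using SS.P.emeasure_space_1 by (simp add: space_walk_space indicator_def)
  also have "(\<Sum>n. emeasure \<Omega> (?E u (n + 1))) = (\<integral>\<^sup>+ z. walk_green P x (u + z) \<partial>P)"
    unfolding walk_green_def
    by (subst nn_integral_suminf) (simp_all add: step measurable_def space_P sets_P del: sum.lessThan_Suc)
  finally show ?thesis by (simp add: add.commute)
qed

text \<open>
  Last exit decomposition: the events that time \<open>n\<close> is the last visit to \<open>y\<close> are disjoint, and
  by independence of the future increments they have probability \<open>P(S\<^sub>n = y) q\<close>, where \<open>q\<close> is the
  probability of no return to the origin. If \<open>q\<close> were \<open>0\<close>, there would almost surely be no last
  visit to the origin, although the visits are finitely many and start at time \<open>0\<close>.
\<close>

lemma walk_green_finite:
  assumes trans: "transient_law P"
  shows "walk_green P x u < \<infinity>"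
proof -
  define W :: "nat \<Rightarrow> (nat \<Rightarrow> int) \<Rightarrow> int" where "W n \<omega> = (\<Sum>j<n. \<omega> j)" for n \<omega>
  define N where "N = {\<omega>. \<forall>m>0. W m \<omega> \<noteq> 0}"
  define A where "A y n = {\<omega>. W n \<omega> = y \<and> (\<forall>m>0. W (n + m) \<omega> \<noteq> y)}" for y n
  have W_sets: "{\<omega>. W n \<omega> = y} \<in> sets \<Omega>" "{\<omega>. W n \<omega> \<noteq> y} \<in> sets \<Omega>" for n y
    unfolding W_def by (rule sets_partial_sum)+
  have N_eq: "N = (\<Inter>m\<in>{0<..}. {\<omega>. W m \<omega> \<noteq> 0})" by (auto simp: N_def)
  have N_sets: "N \<in> sets \<Omega>"
    unfolding N_eq by (intro sets.countable_INT) (auto intro: W_sets)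
  have A_eq: "A y n = {\<omega>. W n \<omega> = y} \<inter> (\<Inter>m\<in>{0<..}. {\<omega>. W (n + m) \<omega> \<noteq> y})" for y n
    by (auto simp: A_def)
  have A_sets: "A y n \<in> sets \<Omega>" for y n
    unfolding A_eq by (intro sets.Int sets.countable_INT) (auto intro: W_sets)
  have comb: "W (n + m) (comb_seq n \<omega> \<omega>') = W n \<omega> + W m \<omega>'" for n m \<omega> \<omega>'
  proof (induction m)
    case 0 show ?case by (simp add: W_def comb_seq_def)
  next
    case (Suc m) then show ?case by (simp add: W_def comb_seq_def)
  qed
  have comb0: "W n (comb_seq n \<omega> \<omega>') = W n \<omega>" for n \<omega> \<omega>'
    using comb[of n 0] by (simp add: W_def)
  have indep: "emeasure \<Omega> (A y n) = emeasure \<Omega> {\<omega>. W n \<omega> = y} * emeasure \<Omega> N" for y n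
  proof -
    let ?c = "\<lambda>(\<omega>, \<omega>' :: nat \<Rightarrow> int). comb_seq n \<omega> \<omega>'"
    have c: "?c \<in> measurable (\<Omega> \<Otimes>\<^sub>M \<Omega>) \<Omega>" by (rule measurable_comb_seq)
    have "emeasure \<Omega> (A y n) = emeasure (distr (\<Omega> \<Otimes>\<^sub>M \<Omega>) \<Omega> ?c) (A y n)"
      by (simp only: SS.PiM_comb_seq)
    also have "\<dots> = emeasure (\<Omega> \<Otimes>\<^sub>M \<Omega>) (?c -` A y n \<inter> space (\<Omega> \<Otimes>\<^sub>M \<Omega>))"
      by (rule emeasure_distr[OF c A_sets])
    also have "?c -` A y n \<inter> space (\<Omega> \<Otimes>\<^sub>M \<Omega>) = {\<omega>. W n \<omega> = y} \<times> N"
      by (auto simp: A_def N_def comb comb0 space_pair_measure space_walk_space)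
    finally show ?thesis
      using SS.P.emeasure_pair_measure_Times[OF W_sets(1) N_sets] by simp
  qed
  have last_unique: False if "\<omega> \<in> A y m" "\<omega> \<in> A y n" "m < n" for \<omega> y m n
  proof -
    have "W (m + k) \<omega> \<noteq> y" if "k > 0" for k using \<open>\<omega> \<in> A y m\<close> that by (simp add: A_def)
    from this[of "n - m"] have "W n \<omega> \<noteq> y" using \<open>m < n\<close> by simp
    then show False using \<open>\<omega> \<in> A y n\<close> by (simp add: A_def)
  qed
  have disj: "disjoint_family (A y)" for y
    unfolding disjoint_family_on_def using last_unique by (metis disjoint_iff linorder_neqE_nat)
  have sum_le: "(\<Sum>n. emeasure \<Omega> {\<omega>. W n \<omega> = y}) * emeasure \<Omega> N \<le> 1" for y
  proof -
    have "(\<Sum>n. emeasure \<Omega> {\<omega>. W n \<omega> = y}) * emeasure \<Omega> N = (\<Sum>n. emeasure \<Omega> (A y n))"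
      by (simp add: indep)
    also have "\<dots> = emeasure \<Omega> (\<Union>n. A y n)"
      by (intro suminf_emeasure) (auto intro: A_sets disj)
    finally show ?thesis by (simp add: SS.P.emeasure_le_1)
  qed
  have "emeasure \<Omega> N \<noteq> 0"
  proof
    assume "emeasure \<Omega> N = 0"
    then have "A 0 n \<in> null_sets \<Omega>" for n by (simp add: null_sets_def A_sets indep)
    then have "AE \<omega> in \<Omega>. \<forall>n. \<omega> \<notin> A 0 n" by (auto simp: AE_all_countable intro: AE_not_in)
    moreover have "AE \<omega> in \<Omega>. \<forall>y. finite {n. W n \<omega> = y}"
      using trans unfolding transient_law_def transient_process_def W_def .
    ultimately have "AE \<omega> in \<Omega>. False"
    proof eventually_elim
      fix \<omega> assume last: "\<forall>n. \<omega> \<notin> A 0 n" and fin: "\<forall>y. finite {n. W n \<omega> = y}"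
      define n where "n = Max {n. W n \<omega> = 0}"
      have fin0: "finite {n. W n \<omega> = 0}" using fin by blast
      have "0 \<in> {n. W n \<omega> = 0}" by (simp add: W_def)
      with Max_in[OF fin0] have "W n \<omega> = 0" unfolding n_def by blast
      moreover have "W (n + m) \<omega> \<noteq> 0" if "m > 0" for m
        using Max_ge[OF fin0, of "n + m"] that unfolding n_def by auto
      ultimately show False using last by (auto simp: A_def)
    qed
    then show False using SS.P.not_empty by (simp add: SS.P.AE_False)
  qed
  moreover have "walk_green P x u = (\<Sum>n. emeasure \<Omega> {\<omega>. W n \<omega> = x - u})"
    unfolding walk_green_def W_def by (simp add: algebra_simps)
  ultimately show ?thesis
    using sum_le[of "x - u"]
    by (metis ennreal_mult_eq_top_iff ennreal_one_neq_top infinity_ennreal_def less_top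
        neq_top_trans)
qed

end

section \<open>Transience of the chain behind a transient walk\<close>

lemma step_op_pos_iff: "0 < step_op Q f x \<longleftrightarrow> (\<exists>y\<in>set_pmf (Q x). 0 < f y)"
proof -
  have "step_op Q f x = 0 \<longleftrightarrow> (\<forall>y\<in>set_pmf (Q x). f y = 0)"
    unfolding step_op_def by (simp add: nn_integral_0_iff_AE AE_measure_pmf_iff)
  then show ?thesis by (auto simp: zero_less_iff_neq_zero)
qed

lemma sets_phi: "sets (\<phi> Q) = UNIV"
  by (simp add: \<phi>_def)

text \<open>
  Extend the Green function \<open>h\<close> of the walk off the axis by the expectation of \<open>h\<close> at the next
  visit to the axis. The extension is superharmonic for the chain: on the axis this is the
  renewal equation of the walk, whose steps have the law of the return position.
\<close>

lemma potential_axis_finite: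
  assumes Q: "translation_invariant Q" "property_F Q" and trans: "transient_law (\<phi> Q)"
  shows "potential Q (indicator {(x, 0)}) (s, 0) < \<infinity>"
proof -
  define h where "h = walk_green (\<phi> Q) x"
  define f where "f y = (if snd y = 0 then h (fst y) else return_limit Q h y)" for y
  have step: "step_op Q f y = return_limit Q h y" for y
    unfolding f_def by (rule return_limit_unfold[symmetric])
  have "indicator {(x, 0)} y + step_op Q f y = f y" for y
  proof (cases "snd y = 0")
    case True
    then obtain u where y: "y = (u, 0)" by (cases y) auto
    have "f y = indicator {x} u + (\<integral>\<^sup>+ z. h (u + z) \<partial>\<phi> Q)"
      by (simp add: f_def y h_def flip: walk_green_unfold[OF prob_space_phi sets_phi])
    also have "\<dots> = indicator {(x, 0)} y + step_op Q f y"
      unfolding step nn_integral_phi[OF Q] by (simp add: y indicator_def)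
    finally show ?thesis ..
  next
    case False
    then show ?thesis by (auto simp: step indicator_def f_def)
  qed
  then have "potential Q (indicator {(x, 0)}) (s, 0) \<le> f (s, 0)"
    by (intro potential_le_superharmonic) simp
  also have "\<dots> < \<infinity>"
    using walk_green_finite[OF prob_space_phi sets_phi trans] by (simp add: f_def h_def)
  finally show ?thesis .
qed

lemma return_limit_one_le: "return_limit Q (\<lambda>_. 1) x \<le> 1"
proof -
  have "return_value Q (\<lambda>_. 1) m x \<le> 1" for m x
  proof (induction m arbitrary: x)
    case (Suc m)
    have "return_value Q (\<lambda>_. 1) (Suc m) x \<le> step_op Q (\<lambda>_. 1) x"
      unfolding return_value.simps by (rule step_op_mono) (simp add: Suc)
    then show ?case by (simp add: step_op_def)
  qed simp
  then show ?thesis unfolding return_limit_def by (rule SUP_least)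
qed

lemma return_limit_one_axis:
  assumes "translation_invariant Q" "property_F Q"
  shows "return_limit Q (\<lambda>_. 1) (u, 0) = 1"
  using prob_space.emeasure_space_1[OF prob_space_phi, of Q]
  by (simp flip: nn_integral_phi[OF assms])

text \<open>
  A return probability is the average of the return probabilities after one step, and an average
  of numbers at most \<open>1\<close> equals \<open>1\<close> only if they all do.
\<close>

lemma return_limit_one_propagates:
  assumes "return_limit Q (\<lambda>_. 1) x = 1" "y \<in> set_pmf (Q x)" "snd y \<noteq> 0"
  shows "return_limit Q (\<lambda>_. 1) y = 1"
proof -
  let ?f = "\<lambda>y. if snd y = 0 then 1 else return_limit Q (\<lambda>_. 1) y"
  have le: "?f z \<le> 1" for z by (simp add: return_limit_one_le)
  have f1: "(\<integral>\<^sup>+ z. ?f z \<partial>measure_pmf (Q x)) = 1"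
    using assms(1) return_limit_unfold[of Q "\<lambda>_. 1" x] by (simp add: step_op_def)
  have "(\<integral>\<^sup>+ z. 1 - ?f z \<partial>measure_pmf (Q x)) = (\<integral>\<^sup>+ z. 1 \<partial>measure_pmf (Q x)) - 1"
    by (subst nn_integral_diff) (use le f1 in auto)
  then have "\<forall>z\<in>set_pmf (Q x). 1 - ?f z = 0"
    by (simp add: nn_integral_0_iff_AE AE_measure_pmf_iff)
  with assms(2,3) have "1 - return_limit Q (\<lambda>_. 1) y = 0" by auto
  then have "1 \<le> return_limit Q (\<lambda>_. 1) y"
    using diff_eq_0_iff_ennreal[of 1 "return_limit Q (\<lambda>_. 1) y"] by simp
  with return_limit_one_le show ?thesis by (rule antisym)
qed

text \<open>
  A state that is reachable from the axis but from which the return to the axis is not certain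
  would give a positive probability of never returning to the axis.
\<close>

lemma return_certain_if_reachable:
  assumes Q: "translation_invariant Q" "property_F Q"
  assumes "(step_op Q ^^ n) (indicator {a}) y > 0" "return_limit Q (\<lambda>_. 1) y = 1"
  shows "return_limit Q (\<lambda>_. 1) a = 1"
  using assms(3,4)
proof (induction n arbitrary: y)
  case 0
  then show ?case by (cases "y = a") simp_all
next
  case (Suc n)
  then obtain y' where y': "y' \<in> set_pmf (Q y)" "(step_op Q ^^ n) (indicator {a}) y' > 0"
    by (auto simp: step_op_pos_iff)
  have "return_limit Q (\<lambda>_. 1) y' = 1"
    using return_limit_one_axis[OF Q, of "fst y'"] return_limit_one_propagates[OF Suc.prems(2) y'(1)]
    by (cases y') auto
  with Suc.IH y'(2) show ?case .
qed

lemma axis_reachable: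
  "return_value Q h m y > 0 \<Longrightarrow> \<exists>j z. (step_op Q ^^ j) (indicator {(z, 0)}) y > 0"
proof (induction m arbitrary: y)
  case (Suc m)
  then obtain y' where y': "y' \<in> set_pmf (Q y)"
    "0 < (if snd y' = 0 then h (fst y') else return_value Q h m y')"
    by (auto simp: step_op_pos_iff simp del: split_paired_Ex)
  have "\<exists>j z. (step_op Q ^^ j) (indicator {(z, 0)}) y' > 0"
  proof (cases "snd y' = 0")
    case True
    then have "(step_op Q ^^ 0) (indicator {(fst y', 0)}) y' > 0" by (cases y') simp
    then show ?thesis by blast
  next
    case False
    with y'(2) Suc.IH show ?thesis by simp
  qed
  then obtain j z where "(step_op Q ^^ j) (indicator {(z, 0)}) y' > 0" by blast
  with y'(1) have "(step_op Q ^^ Suc j) (indicator {(z, 0)}) y > 0"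
    by (auto simp: step_op_pos_iff)
  then show ?case by blast
qed simp

text \<open>
  Off the axis: a state that is never visited has Green function \<open>0\<close>, and from a visited state
  some point of the axis is reachable, so that its Green function is controlled by that point.
\<close>

lemma potential_point_finite:
  assumes Q: "translation_invariant Q" "property_F Q" and trans: "transient_law (\<phi> Q)"
  shows "potential Q (indicator {a}) (s, 0) < \<infinity>"
proof (cases "\<exists>n. (step_op Q ^^ n) (indicator {a}) (s, 0) > 0")
  case True
  then obtain n where n: "(step_op Q ^^ n) (indicator {a}) (s, 0) > 0" by blast
  from return_certain_if_reachable[OF Q n return_limit_one_axis[OF Q]] have "0 < return_limit Q (\<lambda>_. 1) a" by simp
  then obtain m where "0 < return_value Q (\<lambda>_. 1) m a"
    unfolding return_limit_def by (auto simp: less_SUP_iff)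
  then obtain j z where "(step_op Q ^^ j) (indicator {(z, 0)}) a > 0"
    using axis_reachable by blast
  then show ?thesis
    by (rule potential_indicator_finite) (rule potential_axis_finite[OF Q trans])
next
  case False
  then show ?thesis by (simp add: potential_def zero_less_iff_neq_zero)
qed

lemma potential_strip_finite:
  assumes Q: "translation_invariant Q" "property_F Q" and trans: "transient_law (\<phi> Q)"
  shows "potential Q (indicator ({x} \<times> {-1..1})) (s, 0) < \<infinity>"
proof -
  have "w \<in> {-1..1} \<longleftrightarrow> w = -1 \<or> w = 0 \<or> w = 1" for w :: int by auto
  then have "(indicator ({x} \<times> {-1..1}) :: int \<times> int \<Rightarrow> ennreal) =
    (\<lambda>y. indicator {(x, -1)} y + (indicator {(x, 0)} y + indicator {(x, 1)} y))"
    by (auto simp: fun_eq_iff indicator_def)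
  then have "potential Q (indicator ({x} \<times> {-1..1})) (s, 0) =
    potential Q (indicator {(x, -1)}) (s, 0) +
    (potential Q (indicator {(x, 0)}) (s, 0) + potential Q (indicator {(x, 1)}) (s, 0))"
    by (simp add: potential_add)
  then show ?thesis using potential_point_finite[OF Q trans] by simp
qed

section \<open>Transfer of superharmonic functions through the coupling\<close>

lemma pmf_map_eq_infsum:
  assumes "inj g" "f -` {y} = range g"
  shows "pmf (map_pmf f p) y = (\<Sum>\<^sub>\<infinity>w\<in>UNIV. pmf p (g w))"
proof -
  have "pmf (map_pmf f p) y = infsetsum (pmf p) (range g)"
    by (simp add: pmf_map assms(2) measure_pmf_conv_infsetsum)
  also have "\<dots> = infsum (pmf p) (range g)" by (rule infsetsum_infsum) (rule pmf_abs_summable)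
  also have "\<dots> = (\<Sum>\<^sub>\<infinity>w\<in>UNIV. pmf p (g w))"
    by (subst infsum_reindex[OF assms(1)]) (simp add: comp_def)
  finally show ?thesis .
qed

lemma successfully_coupledE:
  assumes "successfully_coupled Q Q'"
  obtains R where
    "\<And>u v w. map_pmf (\<lambda>(u, v, w). (u, v)) (R (u, v, w)) = Q' (u, v)"
    "\<And>u v w. map_pmf (\<lambda>(u, v, w). (u, w)) (R (u, v, w)) = Q (u, w)"
    "\<And>u v w u' v' w'. (u', v', w') \<in> set_pmf (R (u, v, w)) \<Longrightarrow> \<bar>w\<bar> \<le> \<bar>v\<bar> + 1 \<Longrightarrow> \<bar>w'\<bar> \<le> \<bar>v'\<bar> + 1"
proof -
  obtain R :: "int \<times> int \<times> int \<Rightarrow> (int \<times> int \<times> int) pmf" where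
    1: "\<forall>u v w u' v'. (\<Sum>\<^sub>\<infinity>w'\<in>UNIV. pmf (R (u, v, w)) (u', v', w')) = pmf (Q' (u, v)) (u', v')" and
    2: "\<forall>u v w u' w'. (\<Sum>\<^sub>\<infinity>v'\<in>UNIV. pmf (R (u, v, w)) (u', v', w')) = pmf (Q (u, w)) (u', w')" and
    3: "\<forall>u v w u' v' w'. \<bar>w\<bar> \<le> \<bar>v\<bar> + 1 \<and> \<bar>w'\<bar> > \<bar>v'\<bar> + 1 \<longrightarrow> pmf (R (u, v, w)) (u', v', w') = 0"
    using assms unfolding successfully_coupled_def by (elim exE conjE) (rule that)
  show thesis
  proof
    fix u v w u' v' w'
    show "map_pmf (\<lambda>(u, v, w). (u, v)) (R (u, v, w)) = Q' (u, v)"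
    proof (rule pmf_eqI)
      fix y :: "int \<times> int"
      show "pmf (map_pmf (\<lambda>(u, v, w). (u, v)) (R (u, v, w))) y = pmf (Q' (u, v)) y"
        by (subst pmf_map_eq_infsum[where g = "\<lambda>w'. (fst y, snd y, w')"])
           (auto simp: inj_on_def 1)
    qed
    show "map_pmf (\<lambda>(u, v, w). (u, w)) (R (u, v, w)) = Q (u, w)"
    proof (rule pmf_eqI)
      fix y :: "int \<times> int"
      show "pmf (map_pmf (\<lambda>(u, v, w). (u, w)) (R (u, v, w))) y = pmf (Q (u, w)) y"
        by (subst pmf_map_eq_infsum[where g = "\<lambda>v'. (fst y, v', snd y)"])
           (auto simp: inj_on_def 2)
    qed
    show "\<bar>w'\<bar> \<le> \<bar>v'\<bar> + 1" if "(u', v', w') \<in> set_pmf (R (u, v, w))" "\<bar>w\<bar> \<le> \<bar>v\<bar> + 1"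
      using 3[rule_format, of w v v' w' u u'] that by (metis linorder_not_le set_pmf_iff)
  qed
qed

text \<open>
  Run the two chains together until \<open>V\<close> returns to \<open>0\<close>. The coupling preserves
  \<open>\<bar>W\<bar> \<le> \<bar>V\<bar> + 1\<close>, so at that time \<open>W\<close> lies in \<open>{-1, 0, 1}\<close> and the infimum over this strip is
  at most the value of \<open>H\<close> at the current point \<open>(U, W)\<close>; before that time \<open>H\<close> decreases on
  average along \<open>(U, W)\<close>.
\<close>

lemma return_value_strip_Inf_le:
  assumes coupled: "successfully_coupled Q Q'"
    and super: "\<And>y. step_op Q H y \<le> H y"
    and "\<bar>w\<bar> \<le> \<bar>v\<bar> + 1"
  shows "return_value Q' (\<lambda>u. INF w\<in>{-1..1}. H (u, w)) m (u, v) \<le> step_op Q H (u, w)"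
  using assms(3)
proof (induction m arbitrary: u v w)
  case (Suc m)
  obtain R where
    R1: "\<And>u v w. map_pmf (\<lambda>(u, v, w). (u, v)) (R (u, v, w)) = Q' (u, v)" and
    R2: "\<And>u v w. map_pmf (\<lambda>(u, v, w). (u, w)) (R (u, v, w)) = Q (u, w)" and
    R3: "\<And>u v w u' v' w'. (u', v', w') \<in> set_pmf (R (u, v, w)) \<Longrightarrow> \<bar>w\<bar> \<le> \<bar>v\<bar> + 1 \<Longrightarrow> \<bar>w'\<bar> \<le> \<bar>v'\<bar> + 1"
    by (rule successfully_coupledE[OF coupled]) (rule that, assumption+)
  let ?h = "\<lambda>u. INF w\<in>{-1..1}. H (u, w)"
  have "return_value Q' ?h (Suc m) (u, v) =
    (\<integral>\<^sup>+ (u', v', w'). (if v' = 0 then ?h u' else return_value Q' ?h m (u', v')) \<partial>measure_pmf (R (u, v, w)))"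
    unfolding return_value.simps step_op_def R1[of u v w, symmetric] nn_integral_map_pmf
    by (intro nn_integral_cong) (simp split: prod.split)
  also have "\<dots> \<le> (\<integral>\<^sup>+ (u', v', w'). H (u', w') \<partial>measure_pmf (R (u, v, w)))"
  proof (rule nn_integral_mono_AE, unfold AE_measure_pmf_iff, safe)
    fix u' v' w' assume "(u', v', w') \<in> set_pmf (R (u, v, w))"
    then have w': "\<bar>w'\<bar> \<le> \<bar>v'\<bar> + 1" using R3 Suc.prems by blast
    show "(if v' = 0 then ?h u' else return_value Q' ?h m (u', v')) \<le> H (u', w')"
    proof (cases "v' = 0")
      case True
      then have "w' \<in> {-1..1}" using w' by auto
      then show ?thesis using True by (auto intro: INF_lower)
    next
      case False
      then show ?thesis using Suc.IH[OF w', of u'] super[of "(u', w')"] by (auto intro: order_trans)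
    qed
  qed
  also have "\<dots> = step_op Q H (u, w)"
    unfolding step_op_def R2[of u v w, symmetric] nn_integral_map_pmf
    by (intro nn_integral_cong) (simp split: prod.split)
  finally show ?case .
qed simp

text \<open>
  The supermartingale inequality for one full excursion of \<open>V\<close>. Taking the infimum over the strip
  removes \<open>W\<close> from the picture: the inequality holds for whichever \<open>w\<close> in the strip the coupled
  chain starts from, and the result is a function of \<open>u\<close> alone, the same for every \<open>Q'\<close>.
\<close>

lemma strip_Inf_superharmonic:
  assumes coupled: "successfully_coupled Q Q'"
    and Q': "translation_invariant Q'" "property_F Q'"
    and super: "\<And>y. indicator ({x} \<times> {-1..1}) y + step_op Q H y \<le> H y"
  shows "indicator {x} u + (\<integral>\<^sup>+ z. (INF w\<in>{-1..1}. H (u + z, w)) \<partial>\<phi> Q') \<le> (INF w\<in>{-1..1}. H (u, w))"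
proof (rule INF_greatest)
  fix w :: int assume w: "w \<in> {-1..1}"
  have "step_op Q H y \<le> H y" for y
    by (rule order_trans[OF _ super[of y]]) simp
  then have "return_limit Q' (\<lambda>u. INF w\<in>{-1..1}. H (u, w)) (u, 0) \<le> step_op Q H (u, w)"
    unfolding return_limit_def using w
    by (intro SUP_least return_value_strip_Inf_le[OF coupled]) auto
  then have "indicator {x} u + (\<integral>\<^sup>+ z. (INF w\<in>{-1..1}. H (u + z, w)) \<partial>\<phi> Q')
      \<le> indicator ({x} \<times> {-1..1}) (u, w) + step_op Q H (u, w)"
    using w nn_integral_phi[OF Q', of "\<lambda>u. INF w\<in>{-1..1}. H (u, w)" u]
    by (intro add_mono) (auto simp: indicator_def)
  also have "\<dots> \<le> H (u, w)" by (rule super)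
  finally show "indicator {x} u + (\<integral>\<^sup>+ z. (INF w\<in>{-1..1}. H (u + z, w)) \<partial>\<phi> Q') \<le> H (u, w)" .
qed

section \<open>Processes that choose their step law\<close>

lemma nn_integral_discrete:
  fixes N :: "'a::countable measure"
  assumes "sets N = UNIV"
  shows "(\<integral>\<^sup>+ y. f y \<partial>N) = (\<integral>\<^sup>+ y. emeasure N {y} * f y \<partial>count_space UNIV)"
proof -
  have "density (count_space UNIV) (\<lambda>y. emeasure N {y}) = N"
  proof (rule measure_eqI_countable[where A = UNIV])
    fix a :: 'a
    have "(\<integral>\<^sup>+ y. emeasure N {y} * indicator {a} y \<partial>count_space UNIV) = emeasure N {a}"
      by (subst nn_integral_count_space'[of "{a}"]) (auto simp: indicator_def)
    then show "emeasure (density (count_space UNIV) (\<lambda>y. emeasure N {y})) {a} = emeasure N {a}"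
      by (subst emeasure_density) simp_all
  qed (use assms in auto)
  then have "(\<integral>\<^sup>+ y. f y \<partial>N) = (\<integral>\<^sup>+ y. f y \<partial>density (count_space UNIV) (\<lambda>y. emeasure N {y}))"
    by simp
  also have "\<dots> = (\<integral>\<^sup>+ y. emeasure N {y} * f y \<partial>count_space UNIV)"
    by (rule nn_integral_density) simp_all
  finally show ?thesis .
qed

lemma level_set_in_gen_sigma: "{\<omega> \<in> space M. X \<omega> = a} \<in> gen_sigma M X"
  unfolding gen_sigma_def using in_vimage_algebra[of "{a}" "count_space UNIV" X "space M"]
  by (simp add: vimage_def Int_def conj_commute)

lemma gen_sigma_subset_Pow: "gen_sigma M X \<subseteq> Pow (space M)"
  unfolding gen_sigma_def by (metis sets.space_closed space_vimage_algebra)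

lemma sets_history_choice:
  assumes CL: "CL k P M S ix"
  shows "{\<omega> \<in> space M. S 0 \<omega> = s \<and> S n \<omega> = u \<and> ix (Suc n) \<omega> = i} \<in> sets (history_choice M S ix n)"
proof -
  let ?H = "history M S ix n" and ?C = "history_choice M S ix n"
  let ?G = "gen_sigma M (S 0) \<union> (\<Union>l\<in>{1..n}. gen_sigma M (S l) \<union> gen_sigma M (ix l))"
  have G: "?G \<subseteq> Pow (space M)"
    by (intro Un_least UN_least gen_sigma_subset_Pow)
  have H: "A \<in> sets ?H" if "A \<in> ?G" for A
    unfolding history_def sets_measure_of[OF G] using that by (rule sigma_sets.Basic)
  have H_sub: "sets ?H \<subseteq> Pow (space M)"
    using sets.space_closed[of ?H] by (simp add: history_def space_measure_of_conv)
  have C_gen: "sets ?H \<union> gen_sigma M (ix (Suc n)) \<subseteq> Pow (space M)"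
    by (intro Un_least H_sub gen_sigma_subset_Pow)
  have C: "A \<in> sets ?C" if "A \<in> sets ?H \<union> gen_sigma M (ix (Suc n))" for A
    unfolding history_choice_def sets_measure_of[OF C_gen] using that by (rule sigma_sets.Basic)
  have "{\<omega> \<in> space M. S 0 \<omega> = s} \<in> sets ?C"
    by (intro C UnI1 H) (rule level_set_in_gen_sigma)
  moreover have "{\<omega> \<in> space M. S n \<omega> = u} \<in> sets ?C"
  proof (rule C, rule UnI1, rule H)
    show "{\<omega> \<in> space M. S n \<omega> = u} \<in> ?G"
      using level_set_in_gen_sigma[of M "S n" u] by (cases n) auto
  qed
  moreover have "{\<omega> \<in> space M. ix (Suc n) \<omega> = i} \<in> sets ?C"
    by (intro C UnI2 level_set_in_gen_sigma)
  ultimately have "{\<omega> \<in> space M. S 0 \<omega> = s} \<inter> ({\<omega> \<in> space M. S n \<omega> = u} \<inter>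
      {\<omega> \<in> space M. ix (Suc n) \<omega> = i}) \<in> sets ?C"
    by (intro sets.Int)
  then show ?thesis by (simp add: Int_def conj_ac cong: conj_cong)
qed

text \<open>
  The triple \<open>(S\<^sub>0, S\<^sub>n, i(n+1))\<close> takes countably many values and its level sets lie in the
  conditioning \<open>\<sigma>\<close>-algebra, so on each of them the conditional law is an elementary conditional
  probability.
\<close>

lemma CL_step_probability:
  assumes CL: "CL k P M S ix" and P: "\<And>i. prob_space (P i)"
  shows "emeasure M {\<omega> \<in> space M. (S 0 \<omega>, S n \<omega>, ix (Suc n) \<omega>) = (s, u, i) \<and> S (Suc n) \<omega> - S n \<omega> = z}
    = emeasure M {\<omega> \<in> space M. (S 0 \<omega>, S n \<omega>, ix (Suc n) \<omega>) = (s, u, i)} * emeasure (P i) {z}"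
proof -
  interpret M: prob_space M using CL by (simp add: CL_def)
  interpret Pi: prob_space "P i" by (rule P)
  have [measurable]: "S j \<in> measurable M (count_space UNIV)" for j using CL by (simp add: CL_def)
  let ?C = "history_choice M S ix n"
  have sub: "subalgebra M ?C" by (rule subalgebra_history_choice[OF CL])
  interpret C: finite_measure_subalgebra M ?C by unfold_locales (rule sub)
  define B where "B = {\<omega> \<in> space M. S 0 \<omega> = s \<and> S n \<omega> = u \<and> ix (Suc n) \<omega> = i}"
  define D where "D = {\<omega> \<in> space M. S (Suc n) \<omega> - S n \<omega> = z}"
  have BC: "B \<in> sets ?C" unfolding B_def by (rule sets_history_choice[OF CL])
  have B [measurable]: "B \<in> sets M" using BC sub by (auto simp: subalgebra_def)
  have D [measurable]: "D \<in> sets M" unfolding D_def by measurable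
  let ?f = "\<lambda>\<omega>. indicator {z} (S (Suc n) \<omega> - S n \<omega>) :: real"
  have fD: "?f \<omega> = indicator D \<omega>" if "\<omega> \<in> space M" for \<omega>
    using that by (simp add: D_def indicator_def)
  have int: "integrable M ?f"
    by (subst Bochner_Integration.integrable_cong[OF refl fD])
       (simp_all add: integrable_real_indicator M.emeasure_eq_measure)
  have "measure M (B \<inter> D) = (\<integral>\<omega>\<in>B. ?f \<omega> \<partial>M)"
  proof -
    have "(\<integral>\<omega>\<in>B. ?f \<omega> \<partial>M) = (\<integral>\<omega>. indicator (B \<inter> D) \<omega> \<partial>M)"
      unfolding set_lebesgue_integral_def
      by (intro Bochner_Integration.integral_cong) (auto simp: D_def indicator_def)
    then show ?thesis by (simp add: Int_absorb2 sets.sets_into_space)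
  qed
  also have "\<dots> = (\<integral>\<omega>\<in>B. real_cond_exp M ?C ?f \<omega> \<partial>M)"
    by (rule C.real_cond_exp_intA[OF int BC])
  also have "\<dots> = (\<integral>\<omega>. measure (P i) {z} * indicator B \<omega> \<partial>M)"
    unfolding set_lebesgue_integral_def
  proof (rule integral_cong_AE)
    have "AE \<omega> in M. real_cond_exp M ?C ?f \<omega> = measure (P (ix (Suc n) \<omega>)) {z}"
      using CL unfolding CL_def by blast
    then show "AE \<omega> in M. indicat_real B \<omega> *\<^sub>R real_cond_exp M ?C ?f \<omega> = measure (P i) {z} * indicator B \<omega>"
      by eventually_elim (auto simp: indicator_def B_def)
  qed simp_all
  also have "\<dots> = measure (P i) {z} * measure M B" by simp
  finally have "emeasure M (B \<inter> D) = emeasure M B * emeasure (P i) {z}"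
    by (simp add: M.emeasure_eq_measure Pi.emeasure_eq_measure ennreal_mult'' mult.commute)
  then show ?thesis by (simp add: B_def D_def Int_def conj_ac cong: conj_cong)
qed

lemma CL_nn_integral:
  assumes CL: "CL k P M S ix" and P: "\<And>i. prob_space (P i)" "\<And>i. sets (P i) = UNIV"
  shows "(\<integral>\<^sup>+ \<omega>. F (S 0 \<omega>, S n \<omega>, ix (Suc n) \<omega>) (S (Suc n) \<omega> - S n \<omega>) \<partial>M)
    = (\<integral>\<^sup>+ \<omega>. (\<integral>\<^sup>+ z. F (S 0 \<omega>, S n \<omega>, ix (Suc n) \<omega>) z \<partial>P (ix (Suc n) \<omega>)) \<partial>M)"
proof -
  have [measurable]: "S j \<in> measurable M (count_space UNIV)" for j using CL by (simp add: CL_def)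
  have [measurable]: "ix (Suc n) \<in> measurable M (count_space UNIV)" using CL by (simp add: CL_def)
  define Y where "Y \<omega> = (S 0 \<omega>, S n \<omega>, ix (Suc n) \<omega>)" for \<omega>
  define X where "X \<omega> = S (Suc n) \<omega> - S n \<omega>" for \<omega>
  have Y [measurable]: "Y \<in> measurable M (count_space UNIV)"
    unfolding Y_def by measurable
  have YX: "(\<lambda>\<omega>. (Y \<omega>, X \<omega>)) \<in> measurable M (count_space UNIV)"
    unfolding X_def by measurable
  have prob: "emeasure M ((\<lambda>\<omega>. (Y \<omega>, X \<omega>)) -` {(y, z)} \<inter> space M)
      = emeasure M (Y -` {y} \<inter> space M) * emeasure (P (snd (snd y))) {z}" for y z
    using CL_step_probability[OF CL P(1), of n "fst y" "fst (snd y)" "snd (snd y)" z]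
    by (simp add: X_def Y_def vimage_def Int_def conj_ac)
  have "(\<integral>\<^sup>+ \<omega>. F (Y \<omega>) (X \<omega>) \<partial>M)
      = (\<integral>\<^sup>+ yz. F (fst yz) (snd yz) \<partial>distr M (count_space UNIV) (\<lambda>\<omega>. (Y \<omega>, X \<omega>)))"
    by (subst nn_integral_distr[OF YX]) simp_all
  also have "\<dots> = (\<integral>\<^sup>+ yz. emeasure M (Y -` {fst yz} \<inter> space M) *
      emeasure (P (snd (snd (fst yz)))) {snd yz} * F (fst yz) (snd yz) \<partial>count_space UNIV)"
    by (subst nn_integral_discrete) (simp_all add: emeasure_distr[OF YX] prob[symmetric])
  also have "\<dots> = (\<integral>\<^sup>+ y. \<integral>\<^sup>+ z. emeasure M (Y -` {y} \<inter> space M) *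
      (emeasure (P (snd (snd y))) {z} * F y z) \<partial>count_space UNIV \<partial>count_space UNIV)"
    by (subst nn_integral_fst_count_space[symmetric]) (simp add: mult.assoc)
  also have "\<dots> = (\<integral>\<^sup>+ y. emeasure M (Y -` {y} \<inter> space M) *
      (\<integral>\<^sup>+ z. F y z \<partial>P (snd (snd y))) \<partial>count_space UNIV)"
    by (simp add: nn_integral_cmult nn_integral_discrete[OF P(2)])
  also have "\<dots> = (\<integral>\<^sup>+ y. (\<integral>\<^sup>+ z. F y z \<partial>P (snd (snd y))) \<partial>distr M (count_space UNIV) Y)"
    by (subst (2) nn_integral_discrete) (simp_all add: emeasure_distr)
  also have "\<dots> = (\<integral>\<^sup>+ \<omega>. (\<integral>\<^sup>+ z. F (Y \<omega>) z \<partial>P (snd (snd (Y \<omega>)))) \<partial>M)"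
    by (rule nn_integral_distr) simp_all
  finally show ?thesis by (simp add: X_def Y_def)
qed

text \<open>
  A common superharmonic function of all the step laws decreases on average along the process,
  whatever the rule for choosing the laws, and each visit to \<open>x\<close> costs at least \<open>1\<close>.
\<close>

lemma CL_expected_visits_le:
  assumes CL: "CL k P M S ix" and P: "\<And>i. prob_space (P i)" "\<And>i. sets (P i) = UNIV"
    and super: "\<And>i u. i \<in> index_set k \<Longrightarrow> indicator {x} u + (\<integral>\<^sup>+ z. h (u + z) \<partial>P i) \<le> h u"
  shows "(\<Sum>n. emeasure M {\<omega> \<in> space M. S 0 \<omega> = s \<and> S n \<omega> = x}) \<le> h s"
proof -
  interpret M: prob_space M using CL by (simp add: CL_def)
  have [measurable]: "S j \<in> measurable M (count_space UNIV)" for j using CL by (simp add: CL_def)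
  have [measurable]: "ix (Suc n) \<in> measurable M (count_space UNIV)" for n using CL by (simp add: CL_def)
  have meas: "(\<lambda>\<omega>. f (S 0 \<omega>, S n \<omega>, ix (Suc n) \<omega>)) \<in> borel_measurable M"
    for f :: "int \<times> int \<times> nat \<Rightarrow> ennreal" and n
  proof (rule measurable_compose[where g = f and N = "count_space UNIV"])
    show "(\<lambda>\<omega>. (S 0 \<omega>, S n \<omega>, ix (Suc n) \<omega>)) \<in> measurable M (count_space UNIV)" by measurable
  qed simp
  define E where "E n = (\<integral>\<^sup>+ \<omega>. indicator {s} (S 0 \<omega>) * h (S n \<omega>) \<partial>M)" for n
  define V where "V n = emeasure M {\<omega> \<in> space M. S 0 \<omega> = s \<and> S n \<omega> = x}" for n
  have step: "V n + E (Suc n) \<le> E n" for n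
  proof -
    have "E (Suc n) = (\<integral>\<^sup>+ \<omega>. indicator {s} (S 0 \<omega>) * h (S n \<omega> + (S (Suc n) \<omega> - S n \<omega>)) \<partial>M)"
      by (simp add: E_def)
    also have "\<dots> = (\<integral>\<^sup>+ \<omega>. (\<integral>\<^sup>+ z. indicator {s} (S 0 \<omega>) * h (S n \<omega> + z) \<partial>P (ix (Suc n) \<omega>)) \<partial>M)"
      using CL_nn_integral[OF CL P, of "\<lambda>y z. indicator {s} (fst y) * h (fst (snd y) + z)" n]
      by simp
    finally have E_Suc: "E (Suc n) = \<dots>" .
    have V: "V n = (\<integral>\<^sup>+ \<omega>. indicator {s} (S 0 \<omega>) * indicator {x} (S n \<omega>) \<partial>M)"
    proof -
      have "V n = (\<integral>\<^sup>+ \<omega>. indicator {\<omega> \<in> space M. S 0 \<omega> = s \<and> S n \<omega> = x} \<omega> \<partial>M)"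
        unfolding V_def by (subst nn_integral_indicator) simp_all
      also have "\<dots> = (\<integral>\<^sup>+ \<omega>. indicator {s} (S 0 \<omega>) * indicator {x} (S n \<omega>) \<partial>M)"
        by (rule nn_integral_cong) (auto simp: indicator_def)
      finally show ?thesis .
    qed
    have "V n + E (Suc n) = (\<integral>\<^sup>+ \<omega>. indicator {s} (S 0 \<omega>) * indicator {x} (S n \<omega>) +
      (\<integral>\<^sup>+ z. indicator {s} (S 0 \<omega>) * h (S n \<omega> + z) \<partial>P (ix (Suc n) \<omega>)) \<partial>M)"
      unfolding V E_Suc
      by (rule nn_integral_add[symmetric])
         (use meas[of "\<lambda>(s', u, i). indicator {s} s' * indicator {x} u" n]
            meas[of "\<lambda>(s', u, i). \<integral>\<^sup>+ z. indicator {s} s' * h (u + z) \<partial>P i" n] in simp_all)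
    also have "\<dots> \<le> E n"
      unfolding E_def
    proof (rule nn_integral_mono)
      fix \<omega> assume "\<omega> \<in> space M"
      then have "ix (Suc n) \<omega> \<in> index_set k" using CL by (simp add: CL_def)
      from super[OF this, of "S n \<omega>"]
      show "indicator {s} (S 0 \<omega>) * indicator {x} (S n \<omega>) +
          (\<integral>\<^sup>+ z. indicator {s} (S 0 \<omega>) * h (S n \<omega> + z) \<partial>P (ix (Suc n) \<omega>))
          \<le> indicator {s} (S 0 \<omega>) * h (S n \<omega>)"
        by (simp add: indicator_def)
    qed
    finally show ?thesis .
  qed
  have partial: "(\<Sum>n<N. V n) + E N \<le> E 0" for N
  proof (induction N)
    case (Suc N)
    have "(\<Sum>n<Suc N. V n) + E (Suc N) \<le> (\<Sum>n<N. V n) + E N"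
      using step[of N] by (simp add: add.assoc add_left_mono)
    with Suc show ?case by (rule order_trans[rotated])
  qed simp
  have "E 0 \<le> (\<integral>\<^sup>+ \<omega>. h s \<partial>M)"
    unfolding E_def by (rule nn_integral_mono) (simp add: indicator_def)
  then have "E 0 \<le> h s" by (simp add: M.emeasure_space_1)
  moreover have "(\<Sum>n<N. V n) \<le> E 0" for N
    by (rule order_trans[OF _ partial[of N]]) simp
  ultimately have "(\<Sum>n. V n) \<le> h s"
    by (intro suminf_le_const) (auto intro: order_trans)
  then show ?thesis by (simp add: V_def)
qed

text \<open>
  The bound is needed for each starting point separately: \<open>S\<^sub>0\<close> is random, and the expected number
  of visits may be infinite after averaging over its law.
\<close>

lemma transient_process_if_expected_visits_finite:
  fixes S :: "nat \<Rightarrow> 'w \<Rightarrow> int"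
  assumes "prob_space M" and S: "\<And>n. S n \<in> measurable M (count_space UNIV)"
    and fin: "\<And>s x. (\<Sum>n. emeasure M {\<omega> \<in> space M. S 0 \<omega> = s \<and> S n \<omega> = x}) < \<infinity>"
  shows "transient_process M S"
proof -
  interpret M: prob_space M by fact
  note S [measurable]
  have "AE \<omega> in M. S 0 \<omega> = s \<longrightarrow> finite {n. S n \<omega> = x}" for s x
  proof -
    let ?A = "\<lambda>n. {\<omega> \<in> space M. S 0 \<omega> = s \<and> S n \<omega> = x}"
    have "AE \<omega> in M. eventually (\<lambda>n. \<omega> \<in> space M - ?A n) sequentially"
    proof (rule borel_cantelli_AE1)
      show "summable (\<lambda>n. measure M (?A n))"
        using fin[of s x] by (intro summable_suminf_not_top) (auto simp: M.emeasure_eq_measure)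
    qed (auto simp: M.emeasure_eq_measure)
    then show ?thesis
    proof (rule AE_mp, intro AE_I2 impI)
      fix \<omega> assume \<omega>: "\<omega> \<in> space M" "S 0 \<omega> = s" "eventually (\<lambda>n. \<omega> \<in> space M - ?A n) sequentially"
      then obtain N where "\<And>n. n \<ge> N \<Longrightarrow> S n \<omega> \<noteq> x" by (auto simp: eventually_sequentially)
      then have "{n. S n \<omega> = x} \<subseteq> {..<N}" by (force simp: not_le[symmetric])
      then show "finite {n. S n \<omega> = x}" by (rule finite_subset) simp
    qed
  qed
  then have "AE \<omega> in M. \<forall>s x. S 0 \<omega> = s \<longrightarrow> finite {n. S n \<omega> = x}"
    unfolding AE_all_countable by blast
  then show ?thesis unfolding transient_process_def by (rule eventually_mono) blast
qed

theorem theorem2p6: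
  fixes k :: enat
    and Q :: "nat \<Rightarrow> int \<times> int \<Rightarrow> (int \<times> int) pmf"
    and M :: "'w measure"
    and S :: "nat \<Rightarrow> 'w \<Rightarrow> int"
    and ix :: "nat \<Rightarrow> 'w \<Rightarrow> nat"
  assumes "k \<ge> 1"
    and "\<And>i. enat i \<le> k \<Longrightarrow> translation_invariant (Q i)"
    and "\<And>i. enat i \<le> k \<Longrightarrow> property_F (Q i)"
    and "\<And>i. i \<in> index_set k \<Longrightarrow> successfully_coupled (Q 0) (Q i)"
    and "transient_law (\<phi> (Q 0))"
    and "CL k (\<lambda>i. \<phi> (Q i)) M S ix"
  shows "transient_process M S"
proof (rule transient_process_if_expected_visits_finite)
  show "prob_space M" "\<And>n. S n \<in> measurable M (count_space UNIV)"
    using assms(6) by (simp_all add: CL_def)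
  fix s x :: int
  (* The drop of at least 1 of h at x comes from counting every point of the strip over x in H. *)
  define H where "H = potential (Q 0) (indicator ({x} \<times> {-1..1}))"
  define h where "h u = (INF w\<in>{-1..1}. H (u, w))" for u
  have "indicator {x} u + (\<integral>\<^sup>+ z. h (u + z) \<partial>\<phi> (Q i)) \<le> h u" if "i \<in> index_set k" for i u
    unfolding h_def
  proof (rule strip_Inf_superharmonic)
    have "enat i \<le> k" using that by (simp add: index_set_def)
    then show "translation_invariant (Q i)" "property_F (Q i)" by (rule assms(2), rule assms(3))
    show "successfully_coupled (Q 0) (Q i)" using that by (rule assms(4))
    show "indicator ({x} \<times> {-1..1}) y + step_op (Q 0) H y \<le> H y" for y
      unfolding H_def by (simp flip: potential_unfold)
  qed
  then have "(\<Sum>n. emeasure M {\<omega> \<in> space M. S 0 \<omega> = s \<and> S n \<omega> = x}) \<le> h s"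
    by (intro CL_expected_visits_le[OF assms(6)] prob_space_phi sets_phi)
  also have "\<dots> \<le> H (s, 0)" unfolding h_def by (rule INF_lower) simp
  also have "\<dots> < \<infinity>"
    unfolding H_def
    by (intro potential_strip_finite assms(2,3,5)) (simp_all flip: zero_enat_def)
  finally show "(\<Sum>n. emeasure M {\<omega> \<in> space M. S 0 \<omega> = s \<and> S n \<omega> = x}) < \<infinity>" .
qed

end
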